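(* In the AMLI-cycle setting described in the context, assume that the two-grid method converges uniformly with convergence rate $\delta_{TG}$. Let $k\ge 2$ be an integer and consider, for $0<\mu<1$, the scaled and shifted Chebyshev polynomial $$p_k(x)=\frac{1+T_k\left(\frac{1+\mu-2x}{1-\mu}\right)}{1+T_k\left(\frac{1+\mu}{1-\mu}\right)},$$ where $T_k$ is the Chebyshev polynomial of the first kind of degree $k$. Suppose $0<\mu<1$ satisfies $$\mu\le \left[1-p_k(\mu)\right](1-\delta_{TG}).\qquad ( * )$$ Then the AMLI operators $B_\ell$ defined with the polynomial $p=p_k$ satisfy the condition number estimate $$\kappa(B_\ell A_\ell)\le \frac1\mu \quad\text{for all levels } \ell .$$ Moreover, a sufficient condition for the existence of $\mu\in(0,1)$ satisfying $( * )$ (where $p_k$ is the polynomial above built from that same $\mu$) is $$\delta_{TG}<1-\frac1{k^2}.$$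
   Context: AMLI-cycle setting. SPD means symmetric positive definite. Let $J\ge 2$ be the number of levels. For $\ell=1,\dots,J$ let $A_\ell\in\mathbb{R}^{n_\ell\times n_\ell}$ be SPD, and for $\ell=1,\dots,J-1$ let $P_\ell\in\mathbb{R}^{n_\ell\times n_{\ell+1}}$ (prolongation) be such that $A_{\ell+1}=P_\ell^TA_\ell P_\ell$. For $\ell=1,\dots,J-1$ let $M_\ell\in\mathbb{R}^{n_\ell\times n_\ell}$ be a nonsingular matrix (smoother) which is nonexpansive: $\|I-M_\ell A_\ell\|_{A_\ell}\le 1$, where $\|\cdot\|_{A_\ell}$ is the operator norm induced by the inner product $(u,v)_{A_\ell}=(A_\ell u,v)$. Put $\overline{M}_\ell:=M_\ell^T(M_\ell^{-1}+M_\ell^{-T}-A_\ell)M_\ell=M_\ell+M_\ell^T-M_\ell^TA_\ell M_\ell$. Given a polynomial $p$ with $p(0)=1$, the AMLI operators are defined recursively from the coarsest level by $B_J=\widehat B_J=A_J^{-1}$, and $$B_\ell=\overline M_\ell+(I-M_\ell^TA_\ell)P_\ell\widehat B_{\ell+1}P_\ell^T(I-A_\ell M_\ell),\quad \ell=J-1,\dots,1,$$ $$\widehat B_\ell=(I-p(B_\ell A_\ell))A_\ell^{-1},\quad \ell=2,\dots,J-1.$$ The two-grid operator on level $\ell\le J-1$ is $B^{TG}_\ell=\overline M_\ell+(I-M_\ell^TA_\ell)P_\ell A_{\ell+1}^{-1}P_\ell^T(I-A_\ell M_\ell)$. "The two-grid method converges uniformly with convergence rate $\delta_{TG}$" means that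 $\delta_{TG}\in[0,1)$ and, for all $\ell=1,\dots,J-1$, $\lambda_{\min}(B_\ell^{TG}A_\ell)\ge 1-\delta_{TG}$ and $\lambda_{\max}(B_\ell^{TG}A_\ell)\le 1$. $\kappa(B_\ell A_\ell)=\lambda_{\max}(B_\ell A_\ell)/\lambda_{\min}(B_\ell A_\ell)$; a bound $\kappa(B_\ell A_\ell)\le C$ means that all eigenvalues of $B_\ell A_\ell$ are positive and $\lambda_{\max}\le C\lambda_{\min}$. *)

theory Defs
  imports
    "Jordan_Normal_Form.Gauss_Jordan_Elimination"
    "Jordan_Normal_Form.Spectral_Radius"
begin

definition spd_mat :: "real mat \<Rightarrow> bool" where
  "spd_mat A \<longleftrightarrow> square_mat A \<and> A\<^sup>T = A \<and>
     (\<forall>v \<in> carrier_vec (dim_row A). v \<noteq> 0\<^sub>v (dim_row A) \<longrightarrow> 0 < (A *\<^sub>v v) \<bullet> v)"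

text \<open>Meaningful for invertible matrices only.\<close>

abbreviation mat_inv :: "real mat \<Rightarrow> real mat" where
  "mat_inv A \<equiv> the (mat_inverse A)"

definition energy_norm :: "real mat \<Rightarrow> real vec \<Rightarrow> real" where
  "energy_norm A v = sqrt ((A *\<^sub>v v) \<bullet> v)"

definition energy_opnorm :: "real mat \<Rightarrow> real mat \<Rightarrow> real" where
  "energy_opnorm A E =
     Sup {energy_norm A (E *\<^sub>v v) / energy_norm A v | v.
            v \<in> carrier_vec (dim_row A) \<and> v \<noteq> 0\<^sub>v (dim_row A)}"

text \<open>Horner evaluation of a polynomial at a square matrix, analogous to \<^const>\<open>poly\<close>.\<close>

definition poly_mat :: "real poly \<Rightarrow> real mat \<Rightarrow> real mat" where
  "poly_mat p X =
     fold_coeffs (\<lambda>a Y. a \<cdot>\<^sub>m 1\<^sub>m (dim_row X) + X * Y) p (0\<^sub>m (dim_row X) (dim_row X))"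

text \<open>
  Extreme real eigenvalues. They are applied to products \<open>B * A\<close> with \<open>A\<close> symmetric positive
  definite and \<open>B\<close> symmetric; such a product is self-adjoint for the inner product of \<open>A\<close>, so
  all its eigenvalues are real.
\<close>

definition lambda_min :: "real mat \<Rightarrow> real" where
  "lambda_min X = Min (spectrum X)"

definition lambda_max :: "real mat \<Rightarrow> real" where
  "lambda_max X = Max (spectrum X)"

text \<open>
  The bound \<open>\<kappa>(X) \<le> C\<close>. Positivity is required of all complex eigenvalues, so that a
  non-real spectrum is excluded rather than ignored.
\<close>

definition cond_number_le :: "real mat \<Rightarrow> real \<Rightarrow> bool" where
  "cond_number_le X C \<longleftrightarrow>
     (\<forall>z \<in> spectrum (map_mat complex_of_real X). z \<in> \<real> \<and> 0 < Re z) \<and>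
     lambda_max X \<le> C * lambda_min X"

definition symmetrized_smoother :: "real mat \<Rightarrow> real mat \<Rightarrow> real mat" where
  "symmetrized_smoother A M = M\<^sup>T * (mat_inv M + (mat_inv M)\<^sup>T - A) * M"

text \<open>
  One step of the cycle: \<open>A\<close>, \<open>M\<close> and \<open>P\<close> are the matrix, smoother and prolongation of the current
  level, and \<open>C\<close> approximates the inverse of the next coarser matrix.
\<close>

definition cycle_step :: "real mat \<Rightarrow> real mat \<Rightarrow> real mat \<Rightarrow> real mat \<Rightarrow> real mat" where
  "cycle_step A M P C =
     symmetrized_smoother A M
     + (1\<^sub>m (dim_row A) - M\<^sup>T * A) * P * C * P\<^sup>T * (1\<^sub>m (dim_row A) - A * M)"

text \<open>
  In the following, \<open>J\<close> is the number of levels, and the families \<open>A\<close>, \<open>P\<close>, \<open>M\<close> are indexed by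
  the level, with \<open>1\<close> the finest and \<open>J\<close> the coarsest. Only \<open>A l\<close> with \<open>1 \<le> l \<le> J\<close> and \<open>P l\<close>,
  \<open>M l\<close> with \<open>1 \<le> l < J\<close> are relevant.
\<close>

definition two_grid_op ::
    "(nat \<Rightarrow> real mat) \<Rightarrow> (nat \<Rightarrow> real mat) \<Rightarrow> (nat \<Rightarrow> real mat) \<Rightarrow> nat \<Rightarrow> real mat" where
  "two_grid_op A P M l = cycle_step (A l) (M l) (P l) (mat_inv (A (Suc l)))"

definition two_grid_converges_uniformly ::
    "nat \<Rightarrow> (nat \<Rightarrow> real mat) \<Rightarrow> (nat \<Rightarrow> real mat) \<Rightarrow> (nat \<Rightarrow> real mat) \<Rightarrow> real \<Rightarrow> bool" where
  "two_grid_converges_uniformly J A P M \<delta> \<longleftrightarrow>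
     0 \<le> \<delta> \<and> \<delta> < 1 \<and>
     (\<forall>l \<in> {1..<J}. lambda_min (two_grid_op A P M l * A l) \<ge> 1 - \<delta> \<and>
                   lambda_max (two_grid_op A P M l * A l) \<le> 1)"

function amli_B ::
      "real poly \<Rightarrow> nat \<Rightarrow> (nat \<Rightarrow> real mat) \<Rightarrow> (nat \<Rightarrow> real mat) \<Rightarrow> (nat \<Rightarrow> real mat) \<Rightarrow> nat \<Rightarrow> real mat"
  and amli_Bhat ::
      "real poly \<Rightarrow> nat \<Rightarrow> (nat \<Rightarrow> real mat) \<Rightarrow> (nat \<Rightarrow> real mat) \<Rightarrow> (nat \<Rightarrow> real mat) \<Rightarrow> nat \<Rightarrow> real mat"
  where
    "amli_B p J A P M l =
       (if l < J then cycle_step (A l) (M l) (P l) (amli_Bhat p J A P M (Suc l))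
        else mat_inv (A J))"
  | "amli_Bhat p J A P M l =
       (if l < J then (1\<^sub>m (dim_row (A l)) - poly_mat p (amli_B p J A P M l * A l)) * mat_inv (A l)
        else mat_inv (A J))"
  by pat_completeness auto
termination
  by (relation "measure (\<lambda>x. case x of
        Inl (p, J, A, P, M, l) \<Rightarrow> 2 * (J - l)
      | Inr (p, J, A, P, M, l) \<Rightarrow> Suc (2 * (J - l)))") auto

declare amli_B.simps [simp del] amli_Bhat.simps [simp del]

fun cheb_T :: "nat \<Rightarrow> real poly" where
  "cheb_T 0 = 1"
| "cheb_T (Suc 0) = [:0, 1:]"
| "cheb_T (Suc (Suc k)) = [:0, 2:] * cheb_T (Suc k) - cheb_T k"

definition amli_poly :: "nat \<Rightarrow> real \<Rightarrow> real poly" where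
  "amli_poly k \<mu> =
     [:1 / (1 + poly (cheb_T k) ((1 + \<mu>) / (1 - \<mu>))):]
       * (1 + pcompose (cheb_T k) [:(1 + \<mu>) / (1 - \<mu>), - 2 / (1 - \<mu>):])"

lemma poly_amli_poly:
  "poly (amli_poly k \<mu>) x =
     (1 + poly (cheb_T k) ((1 + \<mu> - 2 * x) / (1 - \<mu>))) /
     (1 + poly (cheb_T k) ((1 + \<mu>) / (1 - \<mu>)))"
  by (simp add: amli_poly_def poly_pcompose diff_divide_distrib mult.commute)

end

theory Submission
  imports Defs "Jordan_Normal_Form.DL_Rank"
begin

text \<open>
  Let \<open>X \<le> Y\<close> compare quadratic forms. For a symmetric \<open>B\<close>, the product \<open>B * A\<close> with \<open>A\<close> SPD is
  self-adjoint in the energy inner product, and its eigenvalues lie in \<open>[a, b]\<close> exactly if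
  \<open>a A\<^sup>-\<^sup>1 \<le> B \<le> b A\<^sup>-\<^sup>1\<close> (\<open>smult_mat_inv_loewner_iff\<close>). The order is what makes the levels comparable:
  with \<open>S\<close> the symmetrized smoother, a step of the cycle maps a coarse operator \<open>C\<close> to
  \<open>S + R\<^sup>T C R\<close>, which is monotone in \<open>C\<close>. The smoother being nonexpansive
  means \<open>S \<ge> 0\<close>, so a lower bound \<open>c D \<le> C\<close> with \<open>c \<le> 1\<close> survives the step with the same \<open>c\<close>.

  Set \<open>c = 1 - p\<^sub>k(\<mu>)\<close>. On \<open>[\<mu>, 1]\<close> the argument of the Chebyshev polynomial runs through
  \<open>[-1, 1]\<close>, hence \<open>0 \<le> p\<^sub>k \<le> p\<^sub>k(\<mu>)\<close> there (\<open>amli_poly_bounds\<close>). Suppose that the spectrum of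
  \<open>B * A\<close> on a coarse level lies in \<open>[\<mu>, 1]\<close>. Then the corrected coarse operator lies between
  \<open>c A\<^sup>-\<^sup>1\<close> and \<open>A\<^sup>-\<^sup>1\<close>, so on the next finer level \<open>B\<close> lies between \<open>c\<close> times the two-grid
  operator and the two-grid operator itself. By the two-grid estimate the new spectrum lies in
  \<open>[c (1 - \<delta>), 1]\<close>, and condition \<open>\<mu> \<le> c (1 - \<delta>)\<close> closes the induction
  (\<open>amli_spectral_bounds\<close>). A spectrum in \<open>[\<mu>, 1]\<close> is the condition number bound \<open>1 / \<mu>\<close>.

  For the existence of \<open>\<mu>\<close>, put \<open>\<mu> = tanh\<^sup>2 s\<close>. Then \<open>(1 + \<mu>) / (1 - \<mu>) = cosh (2 s)\<close>, and
  \<open>T\<^sub>k (cosh t) = cosh (k t)\<close> gives \<open>1 - p\<^sub>k(\<mu>) = tanh\<^sup>2 (k s)\<close>. The condition becomes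
  \<open>tanh\<^sup>2 s \<le> (1 - \<delta>) tanh\<^sup>2 (k s)\<close>. Since \<open>tanh\<^sup>2 (k s) / tanh\<^sup>2 s\<close> tends to \<open>k\<^sup>2\<close> as \<open>s\<close> decreases
  to \<open>0\<close>, it holds for small \<open>s\<close> as soon as \<open>(1 - \<delta>) k\<^sup>2 > 1\<close>.

  All statements about eigenvalues rest on one finite-dimensional fact,
  \<open>simultaneous_diagonalization\<close>: an SPD form and a symmetric form have a common orthogonal basis.
\<close>

section \<open>Chebyshev polynomials and the choice of the parameter\<close>

lemma cheb_T_cos: "poly (cheb_T k) (cos t) = cos (real k * t)"
proof (induction k rule: cheb_T.induct)
  case (3 k)
  have "cos (real (Suc (Suc k)) * t) + cos (real k * t) = 2 * cos t * cos (real (Suc k) * t)"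
    using cos_add[of "real (Suc k) * t" t] cos_diff[of "real (Suc k) * t" t]
    by (simp add: algebra_simps)
  then show ?case using 3 by (simp add: algebra_simps)
qed simp_all

lemma cheb_T_cosh: "poly (cheb_T k) (cosh t) = cosh (real k * t)"
proof (induction k rule: cheb_T.induct)
  case (3 k)
  have "cosh (real (Suc (Suc k)) * t) + cosh (real k * t) = 2 * cosh t * cosh (real (Suc k) * t)"
    using cosh_add[of "real (Suc k) * t" t] cosh_diff[of "real (Suc k) * t" t]
    by (simp add: algebra_simps)
  then show ?case using 3 by (simp add: algebra_simps)
qed simp_all

lemma abs_cheb_T_le_1:
  assumes "\<bar>x\<bar> \<le> 1"
  shows "\<bar>poly (cheb_T k) x\<bar> \<le> 1"
  using cheb_T_cos[of k "arccos x"] assms by (simp add: cos_arccos_abs)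

lemma cheb_T_gt_1:
  assumes "x > 1" "k \<ge> 1"
  shows "poly (cheb_T k) x > 1"
proof -
  define t where "t = arcosh x"
  have "cosh t = x" "t > 0"
    using assms by (simp_all add: t_def)
  then show ?thesis
    using cheb_T_cosh[of k t] assms cosh_real_nonneg_less_iff[of 0 "real k * t"] by simp
qed

text \<open>
  The value at \<open>\<mu>\<close> is \<open>2 / (1 + T)\<close> with \<open>T > 1\<close> the Chebyshev value outside \<open>[-1, 1]\<close>, and it is
  the maximum over \<open>[\<mu>, 1]\<close>, because the affine map sends \<open>\<mu>\<close> to \<open>1\<close>, the right end of the interval
  on which \<open>\<bar>T\<^sub>k\<bar> \<le> 1\<close>. The shift by \<open>1\<close> in the numerator makes the polynomial nonnegative there.
\<close>

lemma amli_poly_bounds: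
  assumes "k \<ge> 1" "0 < \<mu>" "\<mu> < 1" 
  shows "0 < poly (amli_poly k \<mu>) \<mu>" "poly (amli_poly k \<mu>) \<mu> < 1"
    "\<And>x. \<mu> \<le> x \<Longrightarrow> x \<le> 1 \<Longrightarrow> 0 \<le> poly (amli_poly k \<mu>) x"
    "\<And>x. \<mu> \<le> x \<Longrightarrow> x \<le> 1 \<Longrightarrow> poly (amli_poly k \<mu>) x \<le> poly (amli_poly k \<mu>) \<mu>"
proof -
  define T where "T = poly (cheb_T k) ((1 + \<mu>) / (1 - \<mu>))"
  have T: "T > 1"
    unfolding T_def using assms by (intro cheb_T_gt_1) (auto simp: field_simps)
  have T1: "poly (cheb_T k) 1 = 1" using cheb_T_cos[of k 0] by simp
  have at_mu: "poly (amli_poly k \<mu>) \<mu> = 2 / (1 + T)"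
    using assms T1 by (simp add: poly_amli_poly T_def)
  show "0 < poly (amli_poly k \<mu>) \<mu>" "poly (amli_poly k \<mu>) \<mu> < 1"
    using T by (simp_all add: at_mu)
  fix x assume x: "\<mu> \<le> x" "x \<le> 1"
  have "\<bar>poly (cheb_T k) ((1 + \<mu> - 2 * x) / (1 - \<mu>))\<bar> \<le> 1"
    using x assms by (intro abs_cheb_T_le_1) (auto simp: abs_le_iff field_simps)
  then show "0 \<le> poly (amli_poly k \<mu>) x" "poly (amli_poly k \<mu>) x \<le> poly (amli_poly k \<mu>) \<mu>"
    using T unfolding at_mu by (auto simp: poly_amli_poly T_def[symmetric] intro!: divide_right_mono)
qed

text \<open>
  The substitution that makes the condition on \<open>\<mu>\<close> explicit: it turns both \<open>\<mu>\<close> and the factor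
  \<open>1 - p\<^sub>k(\<mu>)\<close> into squares of \<open>tanh\<close>, at \<open>s\<close> and at \<open>k s\<close>.
\<close>

lemma amli_poly_at_tanh_sq:
  fixes s :: real
  assumes "s > 0"
  defines "\<mu> \<equiv> (tanh s)\<^sup>2"
  shows "1 - poly (amli_poly k \<mu>) \<mu> = (tanh (real k * s))\<^sup>2"
proof -
  have T1: "poly (cheb_T k) 1 = 1" using cheb_T_cos[of k 0] by simp
  have mu: "\<mu> < 1"
    using assms by (simp add: \<mu>_def power_less_one_iff tanh_real_lt_1 abs_square_less_1)
  have th: "(tanh x)\<^sup>2 = 1 - 1 / (cosh x)\<^sup>2" for x :: real
    by (simp add: tanh_def power_divide sinh_square_eq diff_divide_distrib)
  have "(1 + \<mu>) / (1 - \<mu>) = cosh (2 * s)"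
    unfolding \<mu>_def th cosh_double_cosh by (simp add: field_simps)
  then have "1 - poly (amli_poly k \<mu>) \<mu> = 1 - 2 / (1 + cosh (2 * (real k * s)))"
    using mu T1 by (simp add: poly_amli_poly cheb_T_cosh mult.left_commute)
  also have "\<dots> = (tanh (real k * s))\<^sup>2"
    by (simp add: cosh_double_cosh th)
  finally show ?thesis .
qed

text \<open>
  With \<open>\<mu> = tanh\<^sup>2 s\<close>, both sides of the condition are of order \<open>s\<^sup>2\<close>, with leading coefficients \<open>1\<close>
  and \<open>k\<^sup>2 q\<close>; dividing by \<open>s\<^sup>2\<close> therefore leaves a limit of definite sign.
\<close>

lemma exists_amli_parameter:
  fixes q :: real
  assumes "q > 1 / (real k)\<^sup>2" "k \<ge> 1"
  shows "\<exists>\<mu>. 0 < \<mu> \<and> \<mu> < 1 \<and> \<mu> \<le> (1 - poly (amli_poly k \<mu>) \<mu>) * q"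
proof -
  have lim: "((\<lambda>s. tanh (c * s) / s) \<longlongrightarrow> c) (at_right (0::real))" for c :: real
  proof -
    have "((\<lambda>s. tanh (c * s)) has_real_derivative c) (at 0)"
      by (auto intro!: derivative_eq_intros)
    then have "((\<lambda>s. tanh (c * s) / s) \<longlongrightarrow> c) (at 0)"
      by (simp add: DERIV_def)
    then show ?thesis by (rule tendsto_mono[OF at_le, rotated]) simp
  qed
  have "((\<lambda>s. (tanh (real k * s) / s)\<^sup>2 * q - (tanh (1 * s) / s)\<^sup>2) \<longlongrightarrow> (real k)\<^sup>2 * q - 1\<^sup>2) (at_right 0)"
    by (intro tendsto_intros lim)
  moreover have "(real k)\<^sup>2 * q - 1\<^sup>2 > 0"
    using assms by (simp add: field_simps)
  ultimately have "eventually (\<lambda>s. (tanh (real k * s) / s)\<^sup>2 * q - (tanh (1 * s) / s)\<^sup>2 > 0) (at_right 0)"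
    by (rule order_tendstoD(1))
  moreover have "eventually (\<lambda>s::real. s > 0) (at_right 0)"
    by (rule eventually_at_right_less)
  ultimately have "eventually (\<lambda>s. s > 0 \<and> (tanh (real k * s) / s)\<^sup>2 * q - (tanh (1 * s) / s)\<^sup>2 > 0) (at_right 0)"
    by eventually_elim simp
  then obtain s where s: "s > 0" "(tanh (real k * s) / s)\<^sup>2 * q - (tanh (1 * s) / s)\<^sup>2 > 0"
    using eventually_happens[of _ "at_right (0::real)"] by auto
  then have "(tanh s)\<^sup>2 \<le> (tanh (real k * s))\<^sup>2 * q"
    by (simp add: power_divide field_simps)
  moreover have "0 < (tanh s)\<^sup>2" "(tanh s)\<^sup>2 < 1"
    using s(1) by (simp_all add: abs_square_less_1 tanh_real_lt_1)
  ultimately show ?thesis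
    using amli_poly_at_tanh_sq[OF s(1), of k] by (intro exI[of _ "(tanh s)\<^sup>2"]) simp
qed

section \<open>Quadratic forms and simultaneous diagonalization\<close>

lemma mult_mat_unit_vec:
  fixes W :: "'a :: semiring_1 mat"
  assumes "W \<in> carrier_mat m n" "j < n"
  shows "W *\<^sub>v unit_vec n j = col W j"
  using assms by (intro eq_vecI) (auto simp: scalar_prod_right_unit[of _ n])

lemma smult_mat_mult_vec:
  fixes W :: "'a :: semiring_0 mat"
  assumes "W \<in> carrier_mat m n" "v \<in> carrier_vec n"
  shows "(c \<cdot>\<^sub>m W) *\<^sub>v v = c \<cdot>\<^sub>v (W *\<^sub>v v)"
  using assms by (intro eq_vecI) (auto simp: smult_scalar_prod_distrib[of _ n])

lemma mult_mat_zero_vec: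
  assumes "W \<in> carrier_mat m n"
  shows "W *\<^sub>v 0\<^sub>v n = 0\<^sub>v m"
  using assms by (intro eq_vecI) auto

lemma symmetric_scalar_prod:
  fixes G :: "'a :: comm_semiring_0 mat"
  assumes "G \<in> carrier_mat n n" "G\<^sup>T = G" "x \<in> carrier_vec n" "y \<in> carrier_vec n"
  shows "(G *\<^sub>v x) \<bullet> y = (G *\<^sub>v y) \<bullet> x"
  using transpose_vec_mult_scalar[OF assms(1,4,3)] assms
  by (simp add: comm_scalar_prod[of x n])

lemma symmetric_congruence:
  fixes G :: "'a :: comm_semiring_0 mat"
  assumes "G \<in> carrier_mat n n" "G\<^sup>T = G" "W \<in> carrier_mat n m"
  shows "(W\<^sup>T * G * W)\<^sup>T = W\<^sup>T * G * W"
  using assms by (simp add: transpose_mult[of _ m n _ m] transpose_mult[of _ n n _ m])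

lemma congruence_scalar_prod:
  fixes G :: "'a :: comm_semiring_0 mat"
  assumes "G \<in> carrier_mat n n" "W \<in> carrier_mat n m" "x \<in> carrier_vec m" "y \<in> carrier_vec m"
  shows "((W\<^sup>T * G * W) *\<^sub>v x) \<bullet> y = (G *\<^sub>v (W *\<^sub>v x)) \<bullet> (W *\<^sub>v y)"
  using assms transpose_vec_mult_scalar[OF assms(2) assms(4), of "G *\<^sub>v (W *\<^sub>v x)"]
  by (simp add: assoc_mult_mat_vec[of _ m n _ m] assoc_mult_mat_vec[of _ n n _ m])

lemma index_congruence:
  fixes G :: "'a :: comm_semiring_1 mat"
  assumes "G \<in> carrier_mat n n" "W \<in> carrier_mat n m" "i < m" "j < m"
  shows "(W\<^sup>T * G * W) $$ (i, j) = (G *\<^sub>v col W j) \<bullet> col W i"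
proof -
  have "(W\<^sup>T * G * W) $$ (i, j) = (W\<^sup>T * (G * W)) $$ (i, j)"
    using assms by simp
  also have "\<dots> = row (W\<^sup>T) i \<bullet> col (G * W) j"
    by (rule index_mult_mat(1)) (use assms in auto)
  also have "row (W\<^sup>T) i = col W i"
    by (rule row_transpose) (use assms in auto)
  also have "col (G * W) j = G *\<^sub>v col W j"
    by (rule col_mult2[OF assms(1,2,4)])
  finally show ?thesis
    using assms by (simp add: comm_scalar_prod[of _ n])
qed

lemma spd_matD:
  assumes "spd_mat A" "A \<in> carrier_mat n n"
  shows "A\<^sup>T = A" "\<And>v. v \<in> carrier_vec n \<Longrightarrow> v \<noteq> 0\<^sub>v n \<Longrightarrow> 0 < (A *\<^sub>v v) \<bullet> v"
  using assms by (auto simp: spd_mat_def)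

lemma spd_quadratic_form_nonneg:
  assumes "spd_mat A" "A \<in> carrier_mat n n" "v \<in> carrier_vec n"
  shows "0 \<le> (A *\<^sub>v v) \<bullet> v"
  using spd_matD(2)[OF assms] assms(2)
  by (cases "v = 0\<^sub>v n") (auto simp: mult_mat_zero_vec less_imp_le)

lemma spd_det_nonzero:
  assumes "spd_mat A" "A \<in> carrier_mat n n"
  shows "det A \<noteq> 0"
proof
  assume "det A = 0"
  then obtain v where "v \<in> carrier_vec n" "v \<noteq> 0\<^sub>v n" "A *\<^sub>v v = 0\<^sub>v n"
    using det_0_iff_vec_prod_zero_field[OF assms(2)] by auto
  with spd_matD(2)[OF assms] show False by fastforce
qed

lemma mat_inv_det_nonzero:
  assumes "A \<in> carrier_mat n n" "det A \<noteq> 0"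
  shows "mat_inv A \<in> carrier_mat n n" "A * mat_inv A = 1\<^sub>m n" "mat_inv A * A = 1\<^sub>m n"
proof -
  have "mat_inverse A \<noteq> None"
    using mat_inverse(1)[OF assms(1), where b = "()"] det_non_zero_imp_unit[OF assms, where b = "()"] by blast
  then show "mat_inv A \<in> carrier_mat n n" "A * mat_inv A = 1\<^sub>m n" "mat_inv A * A = 1\<^sub>m n"
    using mat_inverse(2)[OF assms(1)] by auto
qed

lemmas mat_inv_spd = mat_inv_det_nonzero[OF _ spd_det_nonzero]

text \<open>
  The matrix \<open>A\<^sup>-\<^sup>1 G\<close> has a complex eigenvalue. It must be real, since \<open>A\<^sup>-\<^sup>1 G\<close> is self-adjoint in the
  energy inner product; the real or the imaginary part of the eigenvector is then a real eigenvector.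
\<close>

lemma exists_generalized_eigenvector:
  assumes A: "A \<in> carrier_mat n n" "spd_mat A" and G: "G \<in> carrier_mat n n" "G\<^sup>T = G"
    and n: "n > 0"
  shows "\<exists>v a. v \<in> carrier_vec n \<and> v \<noteq> 0\<^sub>v n \<and> G *\<^sub>v v = a \<cdot>\<^sub>v (A *\<^sub>v v)"
proof -
  note inv = mat_inv_spd[OF A(1,2,1)]
  define X where "X = mat_inv A * G"
  have X: "X \<in> carrier_mat n n" using inv G by (simp add: X_def)
  have AX: "A *\<^sub>v (X *\<^sub>v u) = G *\<^sub>v u" if u: "u \<in> carrier_vec n" for u
  proof -
    have "A *\<^sub>v (X *\<^sub>v u) = (A * mat_inv A) *\<^sub>v (G *\<^sub>v u)"
      unfolding X_def using A inv(1) G u by simp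
    then show ?thesis using G u by (simp add: inv(2))
  qed
  let ?X = "map_mat complex_of_real X"
  obtain z w where "eigenvector ?X w z"
    using spectrum_non_empty[of ?X n] X n by (auto simp: spectrum_def eigenvalue_def)
  then have w: "w \<in> carrier_vec n" "w \<noteq> 0\<^sub>v n" "?X *\<^sub>v w = z \<cdot>\<^sub>v w"
    using X by (auto simp: eigenvector_def)
  define x y where "x = map_vec Re w" and "y = map_vec Im w"
  define a b where "a = Re z" and "b = Im z"
  have xy: "x \<in> carrier_vec n" "y \<in> carrier_vec n" using w by (auto simp: x_def y_def)
  have entry: "(\<Sum>j = 0..<n. complex_of_real (X $$ (i, j)) * w $ j) = z * w $ i" if "i < n" for i
    using arg_cong[OF w(3), of "\<lambda>u. u $ i"] that X w(1) by (simp add: scalar_prod_def)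
  have "X *\<^sub>v x = a \<cdot>\<^sub>v x - b \<cdot>\<^sub>v y" 
  proof (rule eq_vecI)
    fix i assume "i < dim_vec (a \<cdot>\<^sub>v x - b \<cdot>\<^sub>v y)"
    then have i: "i < n" using xy by simp
    show "(X *\<^sub>v x) $ i = (a \<cdot>\<^sub>v x - b \<cdot>\<^sub>v y) $ i"
      using arg_cong[OF entry[OF i], of Re] i X w(1)
      by (simp add: scalar_prod_def x_def y_def a_def b_def Re_sum)
  qed (use X xy in simp)
  then have Gx: "G *\<^sub>v x = a \<cdot>\<^sub>v (A *\<^sub>v x) - b \<cdot>\<^sub>v (A *\<^sub>v y)"
    using AX[OF xy(1)] A xy
    by (simp add: mult_minus_distrib_mat_vec[of _ n n] mult_mat_vec[of _ n n])
  have "X *\<^sub>v y = a \<cdot>\<^sub>v y + b \<cdot>\<^sub>v x" 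
  proof (rule eq_vecI)
    fix i assume "i < dim_vec (a \<cdot>\<^sub>v y + b \<cdot>\<^sub>v x)"
    then have i: "i < n" using xy by simp
    show "(X *\<^sub>v y) $ i = (a \<cdot>\<^sub>v y + b \<cdot>\<^sub>v x) $ i"
      using arg_cong[OF entry[OF i], of Im] i X w(1)
      by (simp add: scalar_prod_def x_def y_def a_def b_def Im_sum)
  qed (use X xy in simp)
  then have Gy: "G *\<^sub>v y = a \<cdot>\<^sub>v (A *\<^sub>v y) + b \<cdot>\<^sub>v (A *\<^sub>v x)"
    using AX[OF xy(2)] A xy
    by (simp add: mult_add_distrib_mat_vec[of _ n n] mult_mat_vec[of _ n n])
  \<comment> \<open>The two expressions differ by the imaginary part of the eigenvalue times the
    energy of the complex eigenvector, so symmetry forces that imaginary part to vanish.\<close>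
  have "(G *\<^sub>v x) \<bullet> y = (G *\<^sub>v y) \<bullet> x"
    using symmetric_scalar_prod[OF G xy] .
  then have "b * ((A *\<^sub>v x) \<bullet> x + (A *\<^sub>v y) \<bullet> y) = 0"
    unfolding Gx Gy using A xy symmetric_scalar_prod[OF A(1) spd_matD(1)[OF A(2,1)] xy]
    by (simp add: minus_scalar_prod_distrib[of _ n] add_scalar_prod_distrib[of _ n] distrib_left)
  moreover have xy0: "x \<noteq> 0\<^sub>v n \<or> y \<noteq> 0\<^sub>v n"
  proof (rule ccontr)
    assume "\<not> ?thesis"
    then have "x $ i = 0" "y $ i = 0" if "i < n" for i
      using that by auto
    then have "w $ i = 0" if "i < n" for i
      using that w(1) by (simp add: x_def y_def complex_eq_iff)
    then show False using w by auto
  qed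
  then have "(A *\<^sub>v x) \<bullet> x + (A *\<^sub>v y) \<bullet> y > 0"
    using spd_matD(2)[OF A(2,1)] spd_quadratic_form_nonneg[OF A(2,1)] xy
    by (metis add_pos_nonneg add_nonneg_pos)
  ultimately have "b = 0" by auto
  then have "G *\<^sub>v x = a \<cdot>\<^sub>v (A *\<^sub>v x)" "G *\<^sub>v y = a \<cdot>\<^sub>v (A *\<^sub>v y)"
    using Gx Gy A xy by auto
  then show ?thesis using xy xy0 by blast
qed

lemma exists_matrix_first_col:
  fixes v :: "'a :: field vec"
  assumes v: "v \<in> carrier_vec n" "v \<noteq> 0\<^sub>v n"
  shows "\<exists>W \<in> carrier_mat n n. det W \<noteq> 0 \<and> col W 0 = v"
proof -
  interpret vec_space "TYPE('a)" n .
  let ?b = "basis_completion v"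
  note b = basis_completion[OF v]
  define W where "W = mat_of_cols n ?b"
  have n: "n > 0" using v by (cases n) auto
  have W: "W \<in> carrier_mat n n" using mat_of_cols_carrier(1)[of n ?b] unfolding b(6) W_def .
  have cols: "cols W = ?b" unfolding W_def by (rule cols_mat_of_cols[OF b(2)])
  have "det W \<noteq> 0"
    using det_0_iff_vec_prod_zero_field[OF W] lin_depI[OF W] b(4,5) unfolding cols by blast
  moreover have "col W 0 = v"
  proof -
    have "?b \<noteq> []" using b(6) n by (metis less_irrefl list.size(3))
    then have "?b ! 0 = v" using hd_conv_nth b(7) by metis
    then show ?thesis
      unfolding W_def using b(6) n v by (simp add: col_mat_of_cols)
  qed
  ultimately show ?thesis using W by blast
qed

text \<open>
  One Gram-Schmidt step in the energy inner product: subtracting multiples of the unit vector \<open>v\<close>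
  from the other columns makes them energy-orthogonal to \<open>v\<close>. They need not be orthogonal to each
  other, since the induction below treats the orthogonal complement of \<open>v\<close> as a smaller problem.
\<close>

lemma exists_orthogonal_completion:
  assumes A: "A \<in> carrier_mat n n" "spd_mat A" and v: "v \<in> carrier_vec n" "(A *\<^sub>v v) \<bullet> v = 1"
  shows "\<exists>W \<in> carrier_mat n n. det W \<noteq> 0 \<and> col W 0 = v \<and> (\<forall>j. 0 < j \<and> j < n \<longrightarrow> (A *\<^sub>v v) \<bullet> col W j = 0)"
proof -
  have v0: "v \<noteq> 0\<^sub>v n" using v A by (auto simp: mult_mat_zero_vec)
  have n: "n > 0" using v v0 by (cases n) auto
  obtain W where W: "W \<in> carrier_mat n n" "det W \<noteq> 0" "col W 0 = v"
    using exists_matrix_first_col[OF v(1) v0] by blast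
  define c where "c j = (A *\<^sub>v v) \<bullet> col W j" for j
  define E where "E = mat n n (\<lambda>(i, j). if i = j then 1 else if i = 0 then - c j else 0)"
  \<comment> \<open>Column operations as multiplication by a unit upper triangular matrix keep the
    determinant nonzero.\<close>
  have E: "E \<in> carrier_mat n n" by (simp add: E_def)
  have "det E = prod_list (diag_mat E)"
    by (intro det_upper_triangular[OF _ E]) (auto simp: E_def)
  also have "diag_mat E = replicate n 1"
    by (intro nth_equalityI) (auto simp: diag_mat_def E_def)
  finally have "det E = 1" by simp
  then have "det (W * E) \<noteq> 0" using W E by (simp add: det_mult)
  moreover have "col E 0 = unit_vec n 0"
    using n by (intro eq_vecI) (auto simp: E_def)
  then have "col (W * E) 0 = v"
    using W(3) by (simp only: col_mult2[OF W(1) E n] mult_mat_unit_vec[OF W(1) n])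
  moreover have "(A *\<^sub>v v) \<bullet> col (W * E) j = 0" if j: "0 < j" "j < n" for j
  proof -
    have "col E j = unit_vec n j - c j \<cdot>\<^sub>v unit_vec n 0"
      using n j by (intro eq_vecI) (auto simp: E_def)
    then have "col (W * E) j = W *\<^sub>v (unit_vec n j - c j \<cdot>\<^sub>v unit_vec n 0)"
      by (simp only: col_mult2[OF W(1) E j(2)])
    also have "\<dots> = col W j - c j \<cdot>\<^sub>v v"
      using W n j
      by (simp add: mult_mat_unit_vec mult_minus_distrib_mat_vec[of _ n n] mult_mat_vec[of _ n n])
    finally have "col (W * E) j = col W j - c j \<cdot>\<^sub>v v" .
    then show ?thesis
      using A W j v by (simp add: scalar_prod_minus_distrib[of _ n] c_def)
  qed
  ultimately show ?thesis using W E by (intro bexI[of _ "W * E"]) auto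
qed

text \<open>
  Induction on the dimension. Take an eigenvector \<open>u\<close> with \<open>G u = a A u\<close> and energy norm \<open>1\<close>,
  and complete it to a basis whose other members are energy-orthogonal to \<open>u\<close>. Because \<open>G u\<close> is a
  multiple of \<open>A u\<close>, both forms split off the first coordinate in this basis, and what remains is an
  SPD form and a symmetric form in one dimension less.
\<close>

theorem simultaneous_diagonalization:
  assumes "A \<in> carrier_mat n n" "spd_mat A" "G \<in> carrier_mat n n" "G\<^sup>T = G"
  shows "\<exists>W \<in> carrier_mat n n. \<exists>d. W\<^sup>T * A * W = 1\<^sub>m n \<and> W\<^sup>T * G * W = mat_diag n d"
  using assms
proof (induction n arbitrary: A G)
  case 0
  then show ?case by (intro bexI[of _ "1\<^sub>m 0"] exI[of _ "\<lambda>_. 0"]) (auto intro!: eq_matI simp: mat_diag_def)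
next
  case (Suc m)
  note A = Suc.prems(1,2) and G = Suc.prems(3,4)
  note AT = spd_matD(1)[OF A(2,1)]
  obtain v a where v: "v \<in> carrier_vec (Suc m)" "v \<noteq> 0\<^sub>v (Suc m)" "G *\<^sub>v v = a \<cdot>\<^sub>v (A *\<^sub>v v)"
    using exists_generalized_eigenvector[OF A G] by auto
  define t where "t = (A *\<^sub>v v) \<bullet> v"
  have t: "t > 0" using spd_matD(2)[OF A(2,1)] v by (simp add: t_def)
  define u where "u = (1 / sqrt t) \<cdot>\<^sub>v v"
  have u: "u \<in> carrier_vec (Suc m)" using v by (simp add: u_def)
  have Au: "A *\<^sub>v u = (1 / sqrt t) \<cdot>\<^sub>v (A *\<^sub>v v)"
    using A v by (simp add: u_def mult_mat_vec[of _ "Suc m" "Suc m"])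
  have u1: "(A *\<^sub>v u) \<bullet> u = 1"
    unfolding Au using A v t by (simp add: u_def t_def[symmetric])
  have Gu: "G *\<^sub>v u = a \<cdot>\<^sub>v (A *\<^sub>v u)"
    unfolding Au using G A v
    by (simp add: u_def mult_mat_vec[of _ "Suc m" "Suc m"] smult_smult_assoc mult.commute)
  obtain V where V: "V \<in> carrier_mat (Suc m) (Suc m)" "det V \<noteq> 0" "col V 0 = u"
    and V0: "\<And>j. 0 < j \<Longrightarrow> j < Suc m \<Longrightarrow> (A *\<^sub>v u) \<bullet> col V j = 0"
    using exists_orthogonal_completion[OF A u u1] by blast
  define block where
    "block c X = four_block_mat (c \<cdot>\<^sub>m 1\<^sub>m 1) (0\<^sub>m 1 m) (0\<^sub>m m 1) X" for c and X :: "real mat"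
  define minor where "minor X = mat m m (\<lambda>(i, j). X $$ (Suc i, Suc j))" for X :: "real mat"
  \<comment> \<open>Used for \<open>A\<close> itself with \<open>c = 1\<close> and for \<open>G\<close> with \<open>c = a\<close>.\<close>
  have split: "V\<^sup>T * X * V = block c (minor (V\<^sup>T * X * V))"
    if X: "X \<in> carrier_mat (Suc m) (Suc m)" "X\<^sup>T = X" "X *\<^sub>v u = c \<cdot>\<^sub>v (A *\<^sub>v u)" for c X
  proof (rule eq_matI)
    let ?Y = "V\<^sup>T * X * V"
    fix i j
    assume "i < dim_row (block c (minor ?Y))" "j < dim_col (block c (minor ?Y))"
    then have ij: "i < Suc m" "j < Suc m" by (auto simp: block_def minor_def)
    have col0: "?Y $$ (l, 0) = (if l = 0 then c else 0)" if "l < Suc m" for l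
      using index_congruence[OF X(1) V(1) that, of 0] that A V u u1 V0[of l]
      by (auto simp: X(3))
    have sym: "?Y $$ (i, j) = ?Y $$ (j, i)"
    proof -
      have "?Y $$ (i, j) = ?Y\<^sup>T $$ (j, i)"
        using ij V by (subst index_transpose_mat) auto
      then show ?thesis using symmetric_congruence[OF X(1,2) V(1)] by simp
    qed
    show "?Y $$ (i, j) = block c (minor ?Y) $$ (i, j)"
      using ij sym col0[of i] col0[of j]
      by (cases i; cases j) (simp_all add: block_def minor_def)
  qed (use V in \<open>auto simp: block_def minor_def\<close>)
  have block_congruence: "(block 1 Y)\<^sup>T * block c X * block 1 Y = block c (Y\<^sup>T * X * Y)"
    if XY: "X \<in> carrier_mat m m" "Y \<in> carrier_mat m m" for c X Y
  proof -
    have "(block 1 Y)\<^sup>T = block 1 (Y\<^sup>T)"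
      unfolding block_def using XY by (subst transpose_four_block_mat[of _ 1 1 _ m _ m]) auto
    moreover have "block p X * block q Z = block (p * q) (X * Z)"
      if "X \<in> carrier_mat m m" "Z \<in> carrier_mat m m" for p q X Z
      unfolding block_def using that
      by (subst mult_four_block_mat[of _ 1 1 _ m _ m _ _ 1 _ m]) 
        (auto intro!: cong_four_block_mat simp: mult_smult_assoc_mat[of _ 1 1 _ 1])
    ultimately show ?thesis using XY by simp
  qed
  define A' where "A' = minor (V\<^sup>T * A * V)"
  define G' where "G' = minor (V\<^sup>T * G * V)"
  have A'_block: "V\<^sup>T * A * V = block 1 A'"
    unfolding A'_def using A AT u by (intro split) auto
  have G'_block: "V\<^sup>T * G * V = block a G'"
    unfolding G'_def by (intro split G Gu)
  have A'c: "A' \<in> carrier_mat m m" and G'c: "G' \<in> carrier_mat m m"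
    by (auto simp: A'_def G'_def minor_def)
  have minor_sym: "(minor (V\<^sup>T * X * V))\<^sup>T = minor (V\<^sup>T * X * V)"
    if "X \<in> carrier_mat (Suc m) (Suc m)" "X\<^sup>T = X" for X
  proof (rule eq_matI)
    let ?Y = "V\<^sup>T * X * V"
    fix i j assume "i < dim_row (minor ?Y)" "j < dim_col (minor ?Y)"
    then have ij: "i < m" "j < m" by (auto simp: minor_def)
    have "?Y $$ (Suc j, Suc i) = ?Y\<^sup>T $$ (Suc i, Suc j)"
      using ij V by (subst index_transpose_mat) auto
    then show "(minor ?Y)\<^sup>T $$ (i, j) = minor ?Y $$ (i, j)"
      using ij symmetric_congruence[OF that V(1)] by (simp add: minor_def)
  qed (auto simp: minor_def)
  have "spd_mat A'"
    unfolding spd_mat_def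
  proof (intro conjI ballI impI)
    show "square_mat A'" "A'\<^sup>T = A'"
      using A'c minor_sym[OF A(1) AT] by (auto simp: A'_def)
    fix y :: "real vec" assume "y \<in> carrier_vec (dim_row A')" "y \<noteq> 0\<^sub>v (dim_row A')"
    then have y: "y \<in> carrier_vec m" "y \<noteq> 0\<^sub>v m" using A'c by auto
    \<comment> \<open>Positivity of the minor is positivity of \<open>A\<close> on the span of the columns after the first.\<close>
    define z where "z = 0\<^sub>v 1 @\<^sub>v y"
    have z: "z \<in> carrier_vec (Suc m)"
      using append_carrier_vec[of "0\<^sub>v 1" 1 y m] y by (simp add: z_def)
    have "y = vec m (\<lambda>i. z $ Suc i)" using y by (intro eq_vecI) (auto simp: z_def)
    then have "z \<noteq> 0\<^sub>v (Suc m)" using y by auto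
    then have "V *\<^sub>v z \<noteq> 0\<^sub>v (Suc m)"
      using det_0_iff_vec_prod_zero_field[OF V(1)] V(2) z by blast
    then have "0 < (A *\<^sub>v (V *\<^sub>v z)) \<bullet> (V *\<^sub>v z)"
      using V z by (intro spd_matD(2)[OF A(2,1)]) auto
    also have "\<dots> = ((V\<^sup>T * A * V) *\<^sub>v z) \<bullet> z"
      by (rule congruence_scalar_prod[OF A(1) V(1) z z, symmetric])
    also have "\<dots> = (0\<^sub>v 1 @\<^sub>v (A' *\<^sub>v y)) \<bullet> (0\<^sub>v 1 @\<^sub>v y)"
    proof -
      have "(V\<^sup>T * A * V) *\<^sub>v z = ((1 \<cdot>\<^sub>m 1\<^sub>m 1) *\<^sub>v 0\<^sub>v 1) @\<^sub>v (A' *\<^sub>v y)"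
        unfolding A'_block block_def z_def by (rule mult_mat_vec_split[OF _ A'c _ y(1)]) auto
      also have "(1 \<cdot>\<^sub>m 1\<^sub>m 1) *\<^sub>v 0\<^sub>v 1 = (0\<^sub>v 1 :: real vec)"
        by (rule mult_mat_zero_vec) auto
      finally show ?thesis by (simp only: z_def)
    qed
    also have "\<dots> = (A' *\<^sub>v y) \<bullet> y"
      using A'c y by (subst scalar_prod_append[of _ 1 _ m]) auto
    finally show "0 < (A' *\<^sub>v y) \<bullet> y" .
  qed
  then obtain Y d where Y: "Y \<in> carrier_mat m m" "Y\<^sup>T * A' * Y = 1\<^sub>m m" "Y\<^sup>T * G' * Y = mat_diag m d"
    using Suc.IH[OF A'c _ G'c] minor_sym[OF G] by (auto simp: G'_def)
  have Yc: "block 1 Y \<in> carrier_mat (Suc m) (Suc m)" using Y by (auto simp: block_def)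
  define W where "W = V * block 1 Y"
  have W: "W \<in> carrier_mat (Suc m) (Suc m)" using V Yc by (simp add: W_def)
  have cong: "W\<^sup>T * X * W = (block 1 Y)\<^sup>T * (V\<^sup>T * X * V) * block 1 Y"
    if "X \<in> carrier_mat (Suc m) (Suc m)" for X
  proof -
    let ?n = "Suc m"
    have "W\<^sup>T = (block 1 Y)\<^sup>T * V\<^sup>T" unfolding W_def by (rule transpose_mult[OF V(1) Yc])
    then show ?thesis
      using that V(1) Yc unfolding W_def
      by (simp add: assoc_mult_mat[of _ ?n ?n _ ?n _ ?n])
  qed
  have "W\<^sup>T * A * W = block 1 (1\<^sub>m m)"
    using cong[OF A(1)] block_congruence[OF A'c Y(1)] Y(2) by (simp add: A'_block)
  also have "\<dots> = 1\<^sub>m (Suc m)" 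
    by (rule eq_matI) (auto simp: block_def)
  finally have WA: "W\<^sup>T * A * W = 1\<^sub>m (Suc m)" .
  have "W\<^sup>T * G * W = block a (mat_diag m d)"
    using cong[OF G(1)] block_congruence[OF G'c Y(1)] Y(3) by (simp add: G'_block)
  also have "\<dots> = mat_diag (Suc m) (case_nat a d)"
    by (rule eq_matI) (auto simp: block_def mat_diag_def split: nat.split)
  finally show ?case using W WA by blast
qed

lemma congruence_one_imp_inverse:
  assumes A: "A \<in> carrier_mat n n" "spd_mat A" and W: "W \<in> carrier_mat n n" "W\<^sup>T * A * W = 1\<^sub>m n"
  shows "W * (W\<^sup>T * A) = 1\<^sub>m n" "mat_inv A = W * W\<^sup>T"
proof -
  note inv = mat_inv_spd[OF A(1,2,1)]
  show one: "W * (W\<^sup>T * A) = 1\<^sub>m n"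
    by (rule mat_mult_left_right_inverse[OF _ W(1)]) (use A W in auto)
  have "W * W\<^sup>T = W * W\<^sup>T * (A * mat_inv A)"
    using W inv by simp
  also have "\<dots> = W * (W\<^sup>T * A) * mat_inv A"
    using W A inv(1) by (simp add: assoc_mult_mat[of _ n n _ n _ n])
  finally show "mat_inv A = W * W\<^sup>T"
    using one inv by simp
qed

text \<open>
  The operators of the cycle act like inverses of \<open>A\<close>, hence transform contragrediently: in a basis
  \<open>W\<close> that is orthonormal for \<open>A\<close>, the inverse of \<open>A\<close> is \<open>W W\<^sup>T\<close> and \<open>B\<close> is \<open>W D W\<^sup>T\<close>.
  Diagonalizing the form \<open>A B A\<close> instead of \<open>B\<close> gives this shape.
\<close>

lemma exists_diagonal_factorization:
  assumes A: "A \<in> carrier_mat n n" "spd_mat A" and B: "B \<in> carrier_mat n n" "B\<^sup>T = B"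
  obtains W d where "W \<in> carrier_mat n n" "W\<^sup>T * A * W = 1\<^sub>m n" "B = W * mat_diag n d * W\<^sup>T"
proof -
  note inv = mat_inv_spd[OF A(1,2,1)]
  have G: "A * B * A \<in> carrier_mat n n" "(A * B * A)\<^sup>T = A * B * A"
    using A B symmetric_congruence[OF B A(1)] spd_matD(1)[OF A(2,1)] by auto
  obtain W d where W: "W \<in> carrier_mat n n" "W\<^sup>T * A * W = 1\<^sub>m n"
    and d: "W\<^sup>T * (A * B * A) * W = mat_diag n d"
    using simultaneous_diagonalization[OF A G] by blast
  note one = congruence_one_imp_inverse(1)[OF A W]
  have one': "A * (W * W\<^sup>T) = 1\<^sub>m n"
    using congruence_one_imp_inverse(2)[OF A W] inv by simp
  have "W * mat_diag n d * W\<^sup>T = (W * (W\<^sup>T * A)) * B * (A * (W * W\<^sup>T))"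
    unfolding d[symmetric] using A B W(1) by (simp add: assoc_mult_mat[of _ n n _ n _ n])
  also have "\<dots> = B" unfolding one one' using B by simp
  finally show ?thesis using that[OF W, of d] by simp
qed

lemma diagonal_factorization_symmetric:
  fixes W :: "'a :: comm_semiring_0 mat"
  assumes "W \<in> carrier_mat n n"
  shows "(W * mat_diag n d * W\<^sup>T)\<^sup>T = W * mat_diag n d * W\<^sup>T"
proof -
  have "(mat_diag n d)\<^sup>T = mat_diag n d" by (rule eq_matI) (auto simp: mat_diag_def)
  then show ?thesis
    using symmetric_congruence[of "mat_diag n d" n "W\<^sup>T" n] assms by simp
qed

lemma diagonal_factorization_quadratic_form:
  fixes W :: "real mat"
  assumes "W \<in> carrier_mat n n" "w \<in> carrier_vec n"
  shows "((W * mat_diag n d * W\<^sup>T) *\<^sub>v w) \<bullet> w = (\<Sum>i<n. d i * ((W\<^sup>T *\<^sub>v w) $ i)\<^sup>2)"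
proof -
  have "((W * mat_diag n d * W\<^sup>T) *\<^sub>v w) \<bullet> w = (mat_diag n d *\<^sub>v (W\<^sup>T *\<^sub>v w)) \<bullet> (W\<^sup>T *\<^sub>v w)"
    using congruence_scalar_prod[of "mat_diag n d" n "W\<^sup>T" n w w] assms by simp
  also have "\<dots> = (\<Sum>i<n. d i * ((W\<^sup>T *\<^sub>v w) $ i)\<^sup>2)"
  proof -
    have "mat_diag n d *\<^sub>v y = vec n (\<lambda>i. d i * y $ i)" if "y \<in> carrier_vec n" for y
    proof (rule eq_vecI)
      fix i assume "i < dim_vec (vec n (\<lambda>i. d i * y $ i))"
      then have i: "i < n" by simp
      then have "(mat_diag n d *\<^sub>v y) $ i = (\<Sum>j = 0..<n. if i = j then d j * y $ j else 0)"
        using that by (simp add: mat_diag_def scalar_prod_def if_distrib[of "\<lambda>c. c * _"] cong: if_cong)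
      then show "(mat_diag n d *\<^sub>v y) $ i = vec n (\<lambda>i. d i * y $ i) $ i" using i by simp
    qed (simp add: mat_diag_def)
    then have "mat_diag n d *\<^sub>v (W\<^sup>T *\<^sub>v w) = vec n (\<lambda>i. d i * (W\<^sup>T *\<^sub>v w) $ i)"
      using assms by simp
    then show ?thesis
      using assms
      by (auto simp: scalar_prod_def power2_eq_square mult.assoc lessThan_atLeast0 intro!: sum.cong)
  qed
  finally show ?thesis .
qed


section \<open>Spectrum and polynomials of a product of a symmetric and an SPD matrix\<close>

lemma poly_mat_pCons:
  assumes "X \<in> carrier_mat n n"
  shows "poly_mat (pCons a p) X = a \<cdot>\<^sub>m 1\<^sub>m n + X * poly_mat p X"
  using assms by (cases "p = 0"; cases "a = 0") (auto simp: poly_mat_def)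

lemma poly_mat_diagonal:
  assumes W: "W \<in> carrier_mat n n" "V \<in> carrier_mat n n" "V * W = 1\<^sub>m n" "W * V = 1\<^sub>m n"
  shows "poly_mat p (W * mat_diag n d * V) = W * mat_diag n (\<lambda>i. poly p (d i)) * V"
proof (induction p)
  case 0
  have "mat_diag n (\<lambda>i. 0 :: real) = 0\<^sub>m n n" by (rule eq_matI) (auto simp: mat_diag_def)
  then show ?case using W by (simp add: poly_mat_def carrier_matD[of W n n])
next
  case (pCons a p)
  define D E where "D = mat_diag n d" and "E = mat_diag n (\<lambda>i. poly p (d i))"
  have DE: "D \<in> carrier_mat n n" "E \<in> carrier_mat n n" by (simp_all add: D_def E_def)
  have "poly_mat (pCons a p) (W * D * V) = a \<cdot>\<^sub>m 1\<^sub>m n + (W * D * V) * (W * E * V)"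
    using W DE pCons.IH[folded D_def E_def] by (subst poly_mat_pCons[of _ n]) auto
  also have "(W * D * V) * (W * E * V) = W * D * (V * W) * E * V"
    using W(1,2) DE by (simp add: assoc_mult_mat[of _ n n _ n _ n])
  also have "\<dots> = W * (D * E) * V"
    unfolding W(3) using W(1,2) DE by (simp add: assoc_mult_mat[of _ n n _ n _ n])
  also have "a \<cdot>\<^sub>m 1\<^sub>m n = W * (a \<cdot>\<^sub>m 1\<^sub>m n) * V"
    using W by (simp add: mult_smult_distrib[of _ n n _ n] mult_smult_assoc_mat[of _ n n _ n])
  also have "\<dots> + W * (D * E) * V = W * (a \<cdot>\<^sub>m 1\<^sub>m n + D * E) * V"
    using W(1,2) DE
    by (simp add: add_mult_distrib_mat[of "W * (a \<cdot>\<^sub>m 1\<^sub>m n)" n n "W * (D * E)" V n]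
        mult_add_distrib_mat[of W n n "a \<cdot>\<^sub>m 1\<^sub>m n" n "D * E"] del: assoc_mult_mat)
  also have "a \<cdot>\<^sub>m 1\<^sub>m n + D * E = mat_diag n (\<lambda>i. poly (pCons a p) (d i))"
    unfolding D_def E_def mat_diag_diag by (rule eq_matI) (auto simp: mat_diag_def)
  finally show ?case unfolding D_def .
qed

text \<open>
  Over an arbitrary field, because it is needed for the real spectrum and, with complex entries, to
  exclude further complex eigenvalues.
\<close>

lemma spectrum_diagonal:
  fixes W :: "'a :: field mat"
  assumes W: "W \<in> carrier_mat n n" "V \<in> carrier_mat n n" "V * W = 1\<^sub>m n" "W * V = 1\<^sub>m n"
  shows "spectrum (W * mat_diag n d * V) = d ` {..<n}"
proof -
  let ?D = "mat_diag n d"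
  have X: "W * ?D * V \<in> carrier_mat n n"
    by (intro mult_carrier_mat[of _ n n] W mat_diag_dim)
  have "similar_mat (W * ?D * V) ?D"
    unfolding similar_mat_def
    using W X by (intro exI[of _ W] exI[of _ V] similar_mat_witI[of _ _ n]) auto
  then have "char_poly (W * ?D * V) = char_poly ?D" by (rule char_poly_similar)
  also have "\<dots> = (\<Prod>a\<leftarrow>diag_mat ?D. [:- a, 1:])"
    by (rule char_poly_upper_triangular[of _ n]) (auto simp: mat_diag_def)
  also have "diag_mat ?D = map d [0..<n]"
    by (rule nth_equalityI) (auto simp: diag_mat_def mat_diag_def)
  finally show ?thesis
    unfolding spectrum_root_char_poly[OF X] by (auto simp: poly_prod_list prod_list_zero_iff)
qed

text \<open>
  The Loewner order. Only quadratic forms are compared; symmetry is a separate hypothesis wherever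
  it matters, so that the order itself needs no side conditions.
\<close>

definition loewner_le :: "nat \<Rightarrow> real mat \<Rightarrow> real mat \<Rightarrow> bool" where
  "loewner_le n C D \<longleftrightarrow> (\<forall>w \<in> carrier_vec n. (C *\<^sub>v w) \<bullet> w \<le> (D *\<^sub>v w) \<bullet> w)"

lemma loewner_le_trans:
  "loewner_le n C D \<Longrightarrow> loewner_le n D E \<Longrightarrow> loewner_le n C E"
  unfolding loewner_le_def by (meson order_trans)

lemma smult_quadratic_form:
  fixes C :: "real mat"
  assumes "C \<in> carrier_mat n n" "w \<in> carrier_vec n"
  shows "((c \<cdot>\<^sub>m C) *\<^sub>v w) \<bullet> w = c * ((C *\<^sub>v w) \<bullet> w)"
  using assms by (simp add: smult_mat_mult_vec[of _ n n])

lemma mat_inv_spd_symmetric: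
  assumes "A \<in> carrier_mat n n" "spd_mat A"
  shows "(mat_inv A)\<^sup>T = mat_inv A"
proof -
  note inv = mat_inv_spd[OF assms(1,2,1)]
  have "(mat_inv A)\<^sup>T * A = 1\<^sub>m n"
    using arg_cong[OF inv(2), of transpose_mat] transpose_mult[OF assms(1) inv(1)]
      spd_matD(1)[OF assms(2,1)] by simp
  then have "(mat_inv A)\<^sup>T * A * mat_inv A = mat_inv A"
    using inv by simp
  then show ?thesis
    using inv assms by simp
qed

lemma mat_inv_spd_quadratic_form_nonneg:
  assumes A: "A \<in> carrier_mat n n" "spd_mat A" and w: "w \<in> carrier_vec n"
  shows "0 \<le> (mat_inv A *\<^sub>v w) \<bullet> w"
proof -
  note inv = mat_inv_spd[OF A(1,2,1)]
  let ?v = "mat_inv A *\<^sub>v w"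
  have v: "?v \<in> carrier_vec n" using inv(1) w by simp
  have "A *\<^sub>v ?v = (A * mat_inv A) *\<^sub>v w" using A inv(1) w by simp
  then have "A *\<^sub>v ?v = w" using w by (simp add: inv(2))
  then show ?thesis
    using spd_quadratic_form_nonneg[OF A(2,1) v] comm_scalar_prod[OF v w] by simp
qed

lemma diagonal_factorization_loewner_iff:
  assumes A: "A \<in> carrier_mat n n" "spd_mat A"
    and W: "W \<in> carrier_mat n n" "W\<^sup>T * A * W = 1\<^sub>m n"
  defines "F \<equiv> \<lambda>d. W * mat_diag n d * W\<^sup>T"
  shows "loewner_le n (F d) (F e) \<longleftrightarrow> (\<forall>i<n. d i \<le> e i)"
proof
  assume le: "loewner_le n (F d) (F e)"
  show "\<forall>i<n. d i \<le> e i"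
  proof (intro allI impI)
    fix i assume i: "i < n"
    \<comment> \<open>This vector has coordinates \<open>W\<^sup>T w\<close> equal to the unit vector and so isolates \<open>d i\<close>.\<close>
    define w where "w = A *\<^sub>v (W *\<^sub>v unit_vec n i)"
    have w: "w \<in> carrier_vec n" using A W by (simp add: w_def)
    have "W\<^sup>T *\<^sub>v w = (W\<^sup>T * A * W) *\<^sub>v unit_vec n i"
      using A(1) W(1) by (simp add: w_def assoc_mult_mat_vec[of _ n n _ n])
    also have "\<dots> = unit_vec n i" unfolding W(2) by simp
    finally have "(F g *\<^sub>v w) \<bullet> w = (\<Sum>j<n. if j = i then g j else 0)" for g
      unfolding F_def diagonal_factorization_quadratic_form[OF W(1) w]
      using i by (intro sum.cong) auto
    then show "d i \<le> e i" using le w i by (auto simp: loewner_le_def)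
  qed
next
  assume "\<forall>i<n. d i \<le> e i"
  then show "loewner_le n (F d) (F e)"
    unfolding loewner_le_def F_def
    by (auto simp: diagonal_factorization_quadratic_form[OF W(1)] intro!: sum_mono mult_right_mono)
qed

lemma smult_mat_inv_diagonal:
  assumes A: "A \<in> carrier_mat n n" "spd_mat A"
    and W: "W \<in> carrier_mat n n" "W\<^sup>T * A * W = 1\<^sub>m n"
  shows "c \<cdot>\<^sub>m mat_inv A = W * mat_diag n (\<lambda>_. c) * W\<^sup>T"
proof -
  have "mat_diag n (\<lambda>_. c) = c \<cdot>\<^sub>m 1\<^sub>m n" by (rule eq_matI) (auto simp: mat_diag_def)
  then show ?thesis
    using W(1) congruence_one_imp_inverse(2)[OF A W]
    by (simp add: mult_smult_distrib[of _ n n _ n] mult_smult_assoc_mat[of _ n n _ n])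
qed

lemma diagonal_factorization_mult:
  assumes A: "A \<in> carrier_mat n n" and W: "W \<in> carrier_mat n n"
  shows "W * mat_diag n d * W\<^sup>T * A = W * mat_diag n d * (W\<^sup>T * A)"
  using A W by (intro assoc_mult_mat[of _ n n _ n _ n] mult_carrier_mat[of _ n n]) auto

context
  fixes A B :: "real mat" and n :: nat
  assumes A: "A \<in> carrier_mat n n" "spd_mat A" and B: "B \<in> carrier_mat n n" "B\<^sup>T = B"
begin

text \<open>
  Bounds on the spectrum of \<open>B * A\<close> and bounds on the form of \<open>B\<close> are the same thing, as both say
  that the diagonal entries in a common orthogonal basis are bounded by \<open>c\<close>.
\<close>

lemma smult_mat_inv_loewner_iff:
  shows "loewner_le n (c \<cdot>\<^sub>m mat_inv A) B \<longleftrightarrow> (\<forall>x \<in> spectrum (B * A). c \<le> x)"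
    and "loewner_le n B (c \<cdot>\<^sub>m mat_inv A) \<longleftrightarrow> (\<forall>x \<in> spectrum (B * A). x \<le> c)"
proof -
  obtain W d where W: "W \<in> carrier_mat n n" "W\<^sup>T * A * W = 1\<^sub>m n"
    and Bd: "B = W * mat_diag n d * W\<^sup>T"
    using exists_diagonal_factorization[OF A B] by blast
  have sp: "spectrum (B * A) = d ` {..<n}"
    unfolding Bd diagonal_factorization_mult[OF A(1) W(1)]
    using W A congruence_one_imp_inverse(1)[OF A W] by (intro spectrum_diagonal) auto
  show "loewner_le n (c \<cdot>\<^sub>m mat_inv A) B \<longleftrightarrow> (\<forall>x \<in> spectrum (B * A). c \<le> x)"
    "loewner_le n B (c \<cdot>\<^sub>m mat_inv A) \<longleftrightarrow> (\<forall>x \<in> spectrum (B * A). x \<le> c)"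
    unfolding sp smult_mat_inv_diagonal[OF A W] 
    unfolding Bd diagonal_factorization_loewner_iff[OF A W] by auto
qed

lemma spectrum_symmetric_spd_product:
  shows "finite (spectrum (B * A))" and "n > 0 \<Longrightarrow> spectrum (B * A) \<noteq> {}"
    and "spectrum (map_mat complex_of_real (B * A)) = complex_of_real ` spectrum (B * A)"
proof -
  obtain W d where W: "W \<in> carrier_mat n n" "W\<^sup>T * A * W = 1\<^sub>m n"
    and Bd: "B = W * mat_diag n d * W\<^sup>T"
    using exists_diagonal_factorization[OF A B] by blast
  define V where "V = W\<^sup>T * A"
  have V: "V \<in> carrier_mat n n" "V * W = 1\<^sub>m n" "W * V = 1\<^sub>m n"
    using W A congruence_one_imp_inverse(1)[OF A W] by (auto simp: V_def)
  have BA: "B * A = W * mat_diag n d * V"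
    unfolding Bd V_def by (rule diagonal_factorization_mult[OF A(1) W(1)])
  have sp: "spectrum (B * A) = d ` {..<n}"
    unfolding BA by (rule spectrum_diagonal[OF W(1) V])
  show "finite (spectrum (B * A))" "n > 0 \<Longrightarrow> spectrum (B * A) \<noteq> {}" by (auto simp: sp)
  let ?c = "map_mat complex_of_real"
  have hom: "?c (X * Y) = ?c X * ?c Y" if "X \<in> carrier_mat n n" "Y \<in> carrier_mat n n" for X Y
    using that by (rule of_real_hom.mat_hom_mult)
  have "?c (mat_diag n d) = mat_diag n (\<lambda>i. complex_of_real (d i))"
    by (rule eq_matI) (auto simp: mat_diag_def)
  then have BAc: "?c (B * A) = ?c W * mat_diag n (\<lambda>i. complex_of_real (d i)) * ?c V"
    unfolding BA using W V by (simp add: hom mult_carrier_mat[of _ n n _ n])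
  have "spectrum (?c (B * A)) = (\<lambda>i. complex_of_real (d i)) ` {..<n}"
    unfolding BAc
    by (rule spectrum_diagonal) (use W V hom[of V W] hom[of W V] in \<open>auto simp: of_real_hom.mat_hom_one\<close>)
  then show "spectrum (?c (B * A)) = complex_of_real ` spectrum (B * A)"
    by (auto simp: sp)
qed

text \<open>
  Since \<open>B * A = W D W\<^sup>-\<^sup>1\<close> with \<open>A\<^sup>-\<^sup>1 = W W\<^sup>T\<close>, the correction is \<open>W (1 - p(D)) W\<^sup>T\<close>: it is again
  symmetric, and the polynomial acts on the eigenvalues one by one.
\<close>

lemma polynomial_correction:
  fixes p :: "real poly"
  defines "C \<equiv> (1\<^sub>m n - poly_mat p (B * A)) * mat_inv A"
  shows "C \<in> carrier_mat n n" and "C\<^sup>T = C"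
    and "spectrum (C * A) = (\<lambda>x. 1 - poly p x) ` spectrum (B * A)"
proof -
  obtain W d where W: "W \<in> carrier_mat n n" "W\<^sup>T * A * W = 1\<^sub>m n"
    and Bd: "B = W * mat_diag n d * W\<^sup>T"
    using exists_diagonal_factorization[OF A B] by blast
  define V where "V = W\<^sup>T * A"
  have V: "V \<in> carrier_mat n n" "V * W = 1\<^sub>m n" "W * V = 1\<^sub>m n"
    using W A congruence_one_imp_inverse(1)[OF A W] by (auto simp: V_def)
  have BA: "B * A = W * mat_diag n d * V"
    unfolding Bd V_def by (rule diagonal_factorization_mult[OF A(1) W(1)])
  define E where "E = mat_diag n (\<lambda>i. poly p (d i))"
  have E: "E \<in> carrier_mat n n" by (simp add: E_def)
  have "1\<^sub>m n - poly_mat p (B * A) = W * V - W * E * V"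
    unfolding BA poly_mat_diagonal[OF W(1) V] E_def by (simp only: V(3))
  also have "\<dots> = W * (1\<^sub>m n - E) * V"
    using W(1) V(1) E
    by (simp add: minus_mult_distrib_mat[of W n n "W * E" V n]
        mult_minus_distrib_mat[of W n n "1\<^sub>m n" n E] del: assoc_mult_mat)
  also have "1\<^sub>m n - E = mat_diag n (\<lambda>i. 1 - poly p (d i))" (is "_ = ?F")
    by (rule eq_matI) (auto simp: E_def mat_diag_def)
  finally have "C = W * ?F * V * (W * W\<^sup>T)"
    unfolding C_def congruence_one_imp_inverse(2)[OF A W] by simp
  also have "\<dots> = W * ?F * (V * W) * W\<^sup>T"
  proof -
    define F where "F = ?F"
    have "F \<in> carrier_mat n n" by (simp add: F_def)
    then show ?thesis
      unfolding F_def[symmetric] using W(1) V(1) by (simp add: assoc_mult_mat[of _ n n _ n _ n])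
  qed
  finally have C: "C = W * ?F * W\<^sup>T"
    unfolding V(2) using W by (simp add: right_mult_one_mat[of _ n n] mult_carrier_mat[of _ n n _ n])
  show "C \<in> carrier_mat n n"
    unfolding C by (intro mult_carrier_mat[of _ n n]) (use W in auto)
  show "C\<^sup>T = C" unfolding C by (rule diagonal_factorization_symmetric[OF W(1)])
  have "spectrum (C * A) = (\<lambda>i. 1 - poly p (d i)) ` {..<n}"
    unfolding C diagonal_factorization_mult[OF A(1) W(1)] V_def[symmetric]
    by (rule spectrum_diagonal[OF W(1) V])
  moreover have "spectrum (B * A) = d ` {..<n}"
    unfolding BA by (rule spectrum_diagonal[OF W(1) V])
  ultimately show "spectrum (C * A) = (\<lambda>x. 1 - poly p x) ` spectrum (B * A)" by auto
qed

lemma cond_number_le_of_loewner_bounds: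
  assumes "n > 0" "0 < a"
    and "loewner_le n (a \<cdot>\<^sub>m mat_inv A) B" "loewner_le n B (b \<cdot>\<^sub>m mat_inv A)"
  shows "cond_number_le (B * A) (b / a)"
proof -
  note sp = spectrum_symmetric_spd_product
  have bounds: "\<forall>x \<in> spectrum (B * A). a \<le> x" "\<forall>x \<in> spectrum (B * A). x \<le> b"
    using assms smult_mat_inv_loewner_iff by blast+
  then have "lambda_max (B * A) \<le> b" "a \<le> lambda_min (B * A)"
    using sp(1) sp(2)[OF assms(1)] by (simp_all add: lambda_max_def lambda_min_def)
  moreover have "b \<ge> 0" using bounds sp(2)[OF assms(1)] assms(2) by fastforce
  ultimately have "lambda_max (B * A) \<le> b / a * lambda_min (B * A)"
    using assms(2) mult_left_mono[of a "lambda_min (B * A)" "b / a"] by simp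
  then show ?thesis
    using bounds(1) assms(2) unfolding cond_number_le_def sp(3) by fastforce
qed

end

section \<open>Nonexpansive smoothers and the cycle\<close>

text \<open>
  The supremum that defines the operator norm controls its members only if the set is bounded
  above. A bound comes from the largest eigenvalue of the form \<open>E\<^sup>T A E\<close> relative to \<open>A\<close>.
\<close>

lemma energy_opnorm_le_1D:
  assumes A: "A \<in> carrier_mat n n" "spd_mat A" and E: "E \<in> carrier_mat n n"
    and le: "energy_opnorm A E \<le> 1" and v: "v \<in> carrier_vec n"
  shows "(A *\<^sub>v (E *\<^sub>v v)) \<bullet> (E *\<^sub>v v) \<le> (A *\<^sub>v v) \<bullet> v"
proof -
  note inv = mat_inv_spd[OF A(1,2,1)]
  define G where "G = E\<^sup>T * A * E"
  have G: "G \<in> carrier_mat n n" "G\<^sup>T = G"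
    using E A symmetric_congruence[OF A(1) spd_matD(1)[OF A(2,1)] E] by (auto simp: G_def)
  define B where "B = (mat_inv A)\<^sup>T * G * mat_inv A"
  have B: "B \<in> carrier_mat n n" "B\<^sup>T = B"
    using inv G symmetric_congruence[OF G inv(1)] by (auto simp: B_def)
  \<comment> \<open>Inserting 0 makes \<open>c\<close> nonnegative and covers dimension 0, where the spectrum is empty.\<close>
  define c where "c = Max (insert 0 (spectrum (B * A)))"
  have fin: "finite (spectrum (B * A))" by (rule spectrum_symmetric_spd_product(1)[OF A B])
  have c: "c \<ge> 0" "\<forall>x \<in> spectrum (B * A). x \<le> c" using fin by (auto simp: c_def)
  then have Bc: "loewner_le n B (c \<cdot>\<^sub>m mat_inv A)"
    by (simp add: smult_mat_inv_loewner_iff(2)[OF A B])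
  have bound: "(A *\<^sub>v (E *\<^sub>v x)) \<bullet> (E *\<^sub>v x) \<le> c * ((A *\<^sub>v x) \<bullet> x)" if x: "x \<in> carrier_vec n" for x
  proof -
    have Ax: "A *\<^sub>v x \<in> carrier_vec n" using A x by simp
    have "mat_inv A *\<^sub>v (A *\<^sub>v x) = (mat_inv A * A) *\<^sub>v x" using A inv(1) x by simp
    then have invA: "mat_inv A *\<^sub>v (A *\<^sub>v x) = x" using x by (simp add: inv(3))
    have "(A *\<^sub>v (E *\<^sub>v x)) \<bullet> (E *\<^sub>v x) = (B *\<^sub>v (A *\<^sub>v x)) \<bullet> (A *\<^sub>v x)"
      unfolding B_def congruence_scalar_prod[OF G(1) inv(1) Ax Ax] invA
      unfolding G_def by (rule congruence_scalar_prod[OF A(1) E x x, symmetric])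
    also have "\<dots> \<le> c * (x \<bullet> (A *\<^sub>v x))"
      using bspec[OF Bc[unfolded loewner_le_def] Ax] smult_quadratic_form[OF inv(1) Ax, of c]
      by (simp only: invA)
    finally show ?thesis using comm_scalar_prod[OF x Ax] by simp
  qed
  define S where "S = {energy_norm A (E *\<^sub>v x) / energy_norm A x | x.
      x \<in> carrier_vec (dim_row A) \<and> x \<noteq> 0\<^sub>v (dim_row A)}"
  have pos: "energy_norm A x > 0" if "x \<in> carrier_vec n" "x \<noteq> 0\<^sub>v n" for x
    using spd_matD(2)[OF A(2,1) that] by (simp add: energy_norm_def)
  have "bdd_above S"
  proof (rule bdd_aboveI)
    fix r assume "r \<in> S"
    then obtain x where x: "x \<in> carrier_vec n" "x \<noteq> 0\<^sub>v n" "r = energy_norm A (E *\<^sub>v x) / energy_norm A x"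
      using A by (auto simp: S_def)
    have "energy_norm A (E *\<^sub>v x) \<le> sqrt c * energy_norm A x"
      unfolding energy_norm_def real_sqrt_mult[symmetric] using bound[OF x(1)] by simp
    then show "r \<le> sqrt c" using pos[OF x(1,2)] x(3) by (simp add: divide_le_eq)
  qed
  show ?thesis
  proof (cases "v = 0\<^sub>v n")
    case True
    then show ?thesis using A E by (simp add: mult_mat_zero_vec[of _ n n])
  next
    case False
    have "energy_norm A (E *\<^sub>v v) / energy_norm A v \<in> S"
      using A v False by (auto simp: S_def)
    then have "energy_norm A (E *\<^sub>v v) / energy_norm A v \<le> 1"
      using cSup_upper[OF _ \<open>bdd_above S\<close>] le unfolding energy_opnorm_def S_def[symmetric] by fastforce
    then show ?thesis using pos[OF v False] by (simp add: divide_le_eq energy_norm_def)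
  qed
qed

lemma invertible_mat_det_nonzero:
  fixes M :: "'a :: field mat"
  assumes "M \<in> carrier_mat n n" "invertible_mat M"
  shows "det M \<noteq> 0"
proof -
  obtain N where N: "inverts_mat M N" "inverts_mat N M"
    using assms by (auto simp: invertible_mat_def)
  then have MN: "M * N = 1\<^sub>m n" "N * M = 1\<^sub>m (dim_row N)"
    using assms by (auto simp: inverts_mat_def)
  have "N \<in> carrier_mat n n"
    using arg_cong[OF MN(1), of dim_col] arg_cong[OF MN(2), of dim_col] assms(1)
    by (intro carrier_matI) auto
  then show ?thesis using det_mult[OF assms(1), of N] MN(1) by auto
qed

text \<open>
  For \<open>w = A v\<close> the form of the symmetrized smoother at \<open>w\<close> is the energy of \<open>v\<close> minus the energy of
  \<open>(I - M A) v\<close>. This is the loss of energy in one smoothing step, nonnegative for a nonexpansive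
  smoother.
\<close>

lemma symmetrized_smoother_properties:
  assumes A: "A \<in> carrier_mat n n" "spd_mat A" and M: "M \<in> carrier_mat n n" "invertible_mat M"
    and nonexpansive: "energy_opnorm A (1\<^sub>m n - M * A) \<le> 1"
  shows "symmetrized_smoother A M \<in> carrier_mat n n"
    and "(symmetrized_smoother A M)\<^sup>T = symmetrized_smoother A M"
    and "\<And>w. w \<in> carrier_vec n \<Longrightarrow> 0 \<le> (symmetrized_smoother A M *\<^sub>v w) \<bullet> w"
proof -
  note AT = spd_matD(1)[OF A(2,1)]
  note inv = mat_inv_spd[OF A(1,2,1)]
  note Minv = mat_inv_det_nonzero[OF M(1) invertible_mat_det_nonzero[OF M]]
  define N where "N = mat_inv M"
  note Minv = Minv[folded N_def]
  have NT: "N\<^sup>T \<in> carrier_mat n n" using Minv by simp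
  define S where "S = N + N\<^sup>T - A"
  have S: "S \<in> carrier_mat n n" using A by (simp add: S_def minus_carrier_mat)
  have "S\<^sup>T = N\<^sup>T + N - A"
    unfolding S_def using Minv(1) NT A AT
    by (simp add: transpose_minus[of _ n n] transpose_add[of _ n n])
  also have "N\<^sup>T + N = N + N\<^sup>T" by (rule comm_add_mat[OF NT Minv(1)])
  finally have ST: "S\<^sup>T = S" by (simp add: S_def)
  have eq: "symmetrized_smoother A M = M\<^sup>T * S * M"
    by (simp add: symmetrized_smoother_def S_def N_def)
  show "symmetrized_smoother A M \<in> carrier_mat n n" unfolding eq using M S by simp
  show "(symmetrized_smoother A M)\<^sup>T = symmetrized_smoother A M"
    unfolding eq by (rule symmetric_congruence[OF S ST M(1)])
  fix w :: "real vec" assume w: "w \<in> carrier_vec n"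
  define u where "u = M *\<^sub>v w"
  have u: "u \<in> carrier_vec n" using M w by (simp add: u_def)
  have "N *\<^sub>v u = (N * M) *\<^sub>v w" using M Minv(1) w by (simp add: u_def)
  then have Nu: "N *\<^sub>v u = w" using w by (simp add: Minv(3))
  have "(symmetrized_smoother A M *\<^sub>v w) \<bullet> w = (S *\<^sub>v u) \<bullet> u"
    unfolding eq u_def by (rule congruence_scalar_prod[OF S M(1) w w])
  also have "\<dots> = (N *\<^sub>v u) \<bullet> u + (N\<^sup>T *\<^sub>v u) \<bullet> u - (A *\<^sub>v u) \<bullet> u"
    unfolding S_def using Minv(1) NT A u
    by (simp add: minus_mult_distrib_mat_vec[of _ n n] add_mult_distrib_mat_vec[of _ n n]
        minus_scalar_prod_distrib[of _ n] add_scalar_prod_distrib[of _ n])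
  also have "(N\<^sup>T *\<^sub>v u) \<bullet> u = u \<bullet> w"
    using transpose_vec_mult_scalar[OF Minv(1) u u] by (simp add: Nu)
  finally have form: "(symmetrized_smoother A M *\<^sub>v w) \<bullet> w = 2 * (w \<bullet> u) - (A *\<^sub>v u) \<bullet> u"
    using comm_scalar_prod[OF u w] by (simp add: Nu)
  define v where "v = mat_inv A *\<^sub>v w"
  have v: "v \<in> carrier_vec n" using inv(1) w by (simp add: v_def)
  have "A *\<^sub>v v = (A * mat_inv A) *\<^sub>v w" using A inv(1) w by (simp add: v_def)
  then have Av: "A *\<^sub>v v = w" using w by (simp add: inv(2))
  have Ev: "(1\<^sub>m n - M * A) *\<^sub>v v = v - u"
    using A M v by (simp add: minus_mult_distrib_mat_vec[of _ n n] Av u_def)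
  have Auv: "(A *\<^sub>v u) \<bullet> v = w \<bullet> u"
    using symmetric_scalar_prod[OF A(1) AT u v] by (simp add: Av)
  have Au: "A *\<^sub>v u \<in> carrier_vec n" using A u by simp
  have "(A *\<^sub>v (v - u)) \<bullet> (v - u) \<le> (A *\<^sub>v v) \<bullet> v"
    using energy_opnorm_le_1D[OF A _ nonexpansive v] A M by (simp add: Ev minus_carrier_mat)
  moreover have "(A *\<^sub>v (v - u)) \<bullet> (v - u) = w \<bullet> v - 2 * (w \<bullet> u) + (A *\<^sub>v u) \<bullet> u"
    using A u v w Au
    by (simp add: mult_minus_distrib_mat_vec[of _ n n] minus_scalar_prod_distrib[of _ n]
        scalar_prod_minus_distrib[of _ n] Av Auv)
  ultimately show "0 \<le> (symmetrized_smoother A M *\<^sub>v w) \<bullet> w"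
    unfolding form Av by simp
qed

context
  fixes A M P :: "real mat" and n m :: nat
  assumes A: "A \<in> carrier_mat n n" "spd_mat A" and M: "M \<in> carrier_mat n n" "invertible_mat M"
    and nonexpansive: "energy_opnorm A (1\<^sub>m n - M * A) \<le> 1"
    and P: "P \<in> carrier_mat n m"
begin

text \<open>
  As \<open>A\<close> is symmetric, the factors around the coarse operator in the cycle are transposes of each
  other, so the coarse operator enters through the congruence with \<open>R\<close>.
\<close>

lemma cycle_step_properties:
  assumes C: "C \<in> carrier_mat m m" "C\<^sup>T = C"
  defines "R \<equiv> P\<^sup>T * (1\<^sub>m n - A * M)"
  shows "cycle_step A M P C \<in> carrier_mat n n" "(cycle_step A M P C)\<^sup>T = cycle_step A M P C"
    "\<And>w. w \<in> carrier_vec n \<Longrightarrow> (cycle_step A M P C *\<^sub>v w) \<bullet> w =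
       (symmetrized_smoother A M *\<^sub>v w) \<bullet> w + (C *\<^sub>v (R *\<^sub>v w)) \<bullet> (R *\<^sub>v w)"
proof -
  note S = symmetrized_smoother_properties[OF A M nonexpansive]
  define Q where "Q = 1\<^sub>m n - A * M"
  have Q: "Q \<in> carrier_mat n n" using A M by (simp add: Q_def minus_carrier_mat)
  have R: "R \<in> carrier_mat m n" using P Q by (simp add: R_def Q_def)
  have "Q\<^sup>T = 1\<^sub>m n - M\<^sup>T * A"
    unfolding Q_def using A(1) M(1) spd_matD(1)[OF A(2,1)]
    by (simp add: transpose_minus[of _ n n] transpose_mult[of A n n M n])
  then have RT: "R\<^sup>T = (1\<^sub>m n - M\<^sup>T * A) * P"
    unfolding R_def Q_def[symmetric] using P Q by (simp add: transpose_mult[of "P\<^sup>T" m n Q n])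
  have "cycle_step A M P C = symmetrized_smoother A M + R\<^sup>T * C * R"
  proof -
    have "R\<^sup>T * C * R = R\<^sup>T * C * P\<^sup>T * Q"
      unfolding R_def Q_def[symmetric]
      by (rule assoc_mult_mat[symmetric]) (use R[unfolded R_def Q_def[symmetric]] C P Q in auto)
    then show ?thesis
      using A(1) unfolding cycle_step_def RT Q_def by simp
  qed
  note eq = this
  have RCR: "R\<^sup>T * C * R \<in> carrier_mat n n" using R C by simp
  show "cycle_step A M P C \<in> carrier_mat n n" unfolding eq using S(1) RCR by simp
  show "(cycle_step A M P C)\<^sup>T = cycle_step A M P C"
    unfolding eq transpose_add[OF S(1) RCR] S(2) symmetric_congruence[OF C R] ..
  fix w :: "real vec" assume w: "w \<in> carrier_vec n"
  have "(cycle_step A M P C *\<^sub>v w) \<bullet> w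
      = (symmetrized_smoother A M *\<^sub>v w) \<bullet> w + ((R\<^sup>T * C * R) *\<^sub>v w) \<bullet> w"
    unfolding eq add_mult_distrib_mat_vec[OF S(1) RCR w]
    by (rule add_scalar_prod_distrib[of _ n]) (use S(1) RCR w in auto)
  then show "(cycle_step A M P C *\<^sub>v w) \<bullet> w =
       (symmetrized_smoother A M *\<^sub>v w) \<bullet> w + (C *\<^sub>v (R *\<^sub>v w)) \<bullet> (R *\<^sub>v w)"
    by (simp only: congruence_scalar_prod[OF C(1) R w w])
qed

lemma cycle_step_mono:
  assumes "C \<in> carrier_mat m m" "C\<^sup>T = C" "D \<in> carrier_mat m m" "D\<^sup>T = D" "loewner_le m C D"
  shows "loewner_le n (cycle_step A M P C) (cycle_step A M P D)"
  unfolding loewner_le_def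
proof
  fix w :: "real vec" assume w: "w \<in> carrier_vec n"
  then have "P\<^sup>T * (1\<^sub>m n - A * M) *\<^sub>v w \<in> carrier_vec m"
    using P A M by (simp add: minus_carrier_mat mult_carrier_mat[of _ m n] mult_mat_vec_carrier[of _ m n])
  then show "(cycle_step A M P C *\<^sub>v w) \<bullet> w \<le> (cycle_step A M P D *\<^sub>v w) \<bullet> w"
    using assms(5)
    unfolding cycle_step_properties(3)[OF assms(1,2) w] cycle_step_properties(3)[OF assms(3,4) w]
    by (simp add: loewner_le_def)
qed

text \<open>
  Only the coarse part of the cycle scales with the coarse operator. The smoother part is
  nonnegative and therefore dominates its own multiple by \<open>c \<le> 1\<close>.
\<close>

lemma cycle_step_smult_le:
  assumes "C \<in> carrier_mat m m" "C\<^sup>T = C" "D \<in> carrier_mat m m" "D\<^sup>T = D"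
    and "0 \<le> c" "c \<le> 1" "loewner_le m (c \<cdot>\<^sub>m D) C"
  shows "loewner_le n (c \<cdot>\<^sub>m cycle_step A M P D) (cycle_step A M P C)"
  unfolding loewner_le_def
proof
  fix w :: "real vec" assume w: "w \<in> carrier_vec n"
  define z where "z = P\<^sup>T * (1\<^sub>m n - A * M) *\<^sub>v w"
  have z: "z \<in> carrier_vec m" 
    using w P A M by (simp add: z_def minus_carrier_mat mult_carrier_mat[of _ m n] mult_mat_vec_carrier[of _ m n])
  let ?s = "(symmetrized_smoother A M *\<^sub>v w) \<bullet> w"
  have "0 \<le> ?s" by (rule symmetrized_smoother_properties(3)[OF A M nonexpansive w])
  then have "c * ?s \<le> ?s" using assms(6) by (simp add: mult_left_le_one_le assms(5))
  moreover have "c * ((D *\<^sub>v z) \<bullet> z) \<le> (C *\<^sub>v z) \<bullet> z"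
    using assms(7) z smult_quadratic_form[OF assms(3) z, of c] by (auto simp: loewner_le_def)
  ultimately show "((c \<cdot>\<^sub>m cycle_step A M P D) *\<^sub>v w) \<bullet> w \<le> (cycle_step A M P C *\<^sub>v w) \<bullet> w"
    unfolding smult_quadratic_form[OF cycle_step_properties(1)[OF assms(3,4)] w]
      cycle_step_properties(3)[OF assms(1,2) w] cycle_step_properties(3)[OF assms(3,4) w]
      z_def[symmetric]
    by (simp add: distrib_left)
qed

end

lemma smult_mat_inv_mono:
  assumes A: "A \<in> carrier_mat n n" "spd_mat A" and "a \<le> b"
  shows "loewner_le n (a \<cdot>\<^sub>m mat_inv A) (b \<cdot>\<^sub>m mat_inv A)"
  using mat_inv_spd_quadratic_form_nonneg[OF A] mat_inv_spd(1)[OF A(1,2,1)] assms(3)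
  by (simp add: loewner_le_def smult_quadratic_form mult_right_mono)

lemma loewner_le_smult:
  assumes "C \<in> carrier_mat n n" "D \<in> carrier_mat n n" "0 \<le> c" "loewner_le n C D"
  shows "loewner_le n (c \<cdot>\<^sub>m C) (c \<cdot>\<^sub>m D)"
  using assms by (simp add: loewner_le_def smult_quadratic_form mult_left_mono)

text \<open>
  The spectral interval \<open>[\<mu>, 1]\<close> reproduces itself from each level to the next finer one. The
  polynomial enters only through its range on this interval, and \<open>1 - c\<close> is its upper bound there.
  The factor \<open>1\<close> in the last bound gives both bounds the shape of \<open>smult_mat_inv_loewner_iff\<close>.
\<close>

lemma amli_spectral_bounds:
  fixes A P M :: "nat \<Rightarrow> real mat"
  assumes A: "\<And>l. l \<in> {1..J} \<Longrightarrow> A l \<in> carrier_mat (n l) (n l)" "\<And>l. l \<in> {1..J} \<Longrightarrow> spd_mat (A l)"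
    and P: "\<And>l. l \<in> {1..<J} \<Longrightarrow> P l \<in> carrier_mat (n l) (n (Suc l))"
    and M: "\<And>l. l \<in> {1..<J} \<Longrightarrow> M l \<in> carrier_mat (n l) (n l)"
      "\<And>l. l \<in> {1..<J} \<Longrightarrow> invertible_mat (M l)"
    and nonexpansive: "\<And>l. l \<in> {1..<J} \<Longrightarrow> energy_opnorm (A l) (1\<^sub>m (n l) - M l * A l) \<le> 1"
    and TG: "two_grid_converges_uniformly J A P M \<delta>"
    and p: "\<And>x. \<mu> \<le> x \<Longrightarrow> x \<le> 1 \<Longrightarrow> 0 \<le> poly p x \<and> poly p x \<le> 1 - c"
    and c: "0 \<le> c" "c \<le> 1" and \<mu>: "\<mu> \<le> c * (1 - \<delta>)"
    and l: "l \<in> {1..J}"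
  defines "B \<equiv> amli_B p J A P M" 
  shows "B l \<in> carrier_mat (n l) (n l) \<and> (B l)\<^sup>T = B l
    \<and> loewner_le (n l) (\<mu> \<cdot>\<^sub>m mat_inv (A l)) (B l)
    \<and> loewner_le (n l) (B l) (1 \<cdot>\<^sub>m mat_inv (A l))"
proof -
  have one: "1 \<cdot>\<^sub>m X = X" for X :: "real mat" by (rule eq_matI) auto
  have \<delta>: "0 \<le> \<delta>" "\<delta> < 1" using TG by (auto simp: two_grid_converges_uniformly_def)
  have \<mu>1: "\<mu> \<le> 1"
    using \<mu> mult_mono[of c 1 "1 - \<delta>" 1] c \<delta> by simp
  from l have "1 \<le> l" "l \<le> J" by auto
  from this(2,1) show ?thesis
  proof (induction l rule: inc_induct)
    case base
    then have J: "J \<in> {1..J}" by simp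
    note AJ = A(1)[OF J] A(2)[OF J]
    have "B J = 1 \<cdot>\<^sub>m mat_inv (A J)" unfolding B_def amli_B.simps[of p J] one by simp
    then show ?case
      using mat_inv_spd(1)[OF AJ(1,2,1)] mat_inv_spd_symmetric[OF AJ] 
        smult_mat_inv_mono[OF AJ \<mu>1]
      by (simp add: one loewner_le_def)
  next
    case (step l)
    then have l: "l \<in> {1..J}" "l \<in> {1..<J}" and Sl: "Suc l \<in> {1..J}" by auto
    note Al = A(1)[OF l(1)] A(2)[OF l(1)] and AS = A(1)[OF Sl] A(2)[OF Sl]
    define C where "C = amli_Bhat p J A P M (Suc l)"
    define D where "D = mat_inv (A (Suc l))"
    have D: "D \<in> carrier_mat (n (Suc l)) (n (Suc l))" "D\<^sup>T = D"
      unfolding D_def by (rule mat_inv_spd(1)[OF AS(1,2,1)], rule mat_inv_spd_symmetric[OF AS])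
    \<comment> \<open>On the coarsest level the solve is exact; elsewhere the polynomial maps the
      coarse spectrum from \<open>[\<mu>, 1]\<close> into \<open>[c, 1]\<close>.\<close>
    have "C \<in> carrier_mat (n (Suc l)) (n (Suc l)) \<and> C\<^sup>T = C
        \<and> loewner_le (n (Suc l)) (c \<cdot>\<^sub>m D) C \<and> loewner_le (n (Suc l)) C D"
    proof (cases "Suc l < J")
      case False
      then have "J = Suc l" using l by auto
      then have "C = D" unfolding C_def D_def amli_Bhat.simps[of p J] by simp
      then show ?thesis
        using D smult_mat_inv_mono[OF AS c(2)] by (simp add: D_def[symmetric] one loewner_le_def)
    next
      case True
      let ?B = "B (Suc l)"
      have IH: "?B \<in> carrier_mat (n (Suc l)) (n (Suc l))" "?B\<^sup>T = ?B"
        "loewner_le (n (Suc l)) (\<mu> \<cdot>\<^sub>m mat_inv (A (Suc l))) ?B"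
        "loewner_le (n (Suc l)) ?B (1 \<cdot>\<^sub>m mat_inv (A (Suc l)))"
        using step.IH by auto
      have Ceq: "C = (1\<^sub>m (n (Suc l)) - poly_mat p (?B * A (Suc l))) * mat_inv (A (Suc l))"
        using True AS(1) unfolding C_def B_def amli_Bhat.simps[of p J] by auto
      note corr = polynomial_correction[OF AS IH(1,2), of p, folded Ceq]
      have "\<forall>x \<in> spectrum (?B * A (Suc l)). \<mu> \<le> x \<and> x \<le> 1"
        using IH(3,4) smult_mat_inv_loewner_iff[OF AS IH(1,2)] by blast
      then have "\<forall>y \<in> spectrum (C * A (Suc l)). c \<le> y \<and> y \<le> 1"
        using p unfolding corr(3) by fastforce
      then show ?thesis
        using corr(1,2) smult_mat_inv_loewner_iff[OF AS corr(1,2), of c]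
          smult_mat_inv_loewner_iff[OF AS corr(1,2), of 1]
        by (simp add: D_def one)
    qed
    then have C: "C \<in> carrier_mat (n (Suc l)) (n (Suc l))" "C\<^sup>T = C"
      "loewner_le (n (Suc l)) (c \<cdot>\<^sub>m D) C" "loewner_le (n (Suc l)) C D" by auto
    note hyps = Al M[OF l(2)] nonexpansive[OF l(2)] P[OF l(2)]
    define T where "T = cycle_step (A l) (M l) (P l) D"
    have T: "T \<in> carrier_mat (n l) (n l)" "T\<^sup>T = T"
      unfolding T_def using cycle_step_properties(1,2)[OF hyps D] by auto
    have Bl: "B l = cycle_step (A l) (M l) (P l) C"
      using l unfolding B_def C_def amli_B.simps[of p J] by simp
    have "two_grid_op A P M l = T" by (simp add: two_grid_op_def T_def D_def)
    then have Tlam: "1 - \<delta> \<le> lambda_min (T * A l)" "lambda_max (T * A l) \<le> 1"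
      using TG l(2) by (auto simp: two_grid_converges_uniformly_def)
    have fin: "finite (spectrum (T * A l))"
      by (rule spectrum_symmetric_spd_product(1)[OF Al T])
    have "\<forall>x \<in> spectrum (T * A l). 1 - \<delta> \<le> x \<and> x \<le> 1"
      using Tlam Min_le[OF fin] Max_ge[OF fin] unfolding lambda_min_def lambda_max_def
      by (meson order_trans)
    then have T_bounds: "loewner_le (n l) ((1 - \<delta>) \<cdot>\<^sub>m mat_inv (A l)) T"
      "loewner_le (n l) T (1 \<cdot>\<^sub>m mat_inv (A l))"
      using smult_mat_inv_loewner_iff[OF Al T] by blast+
    \<comment> \<open>The chain is \<open>\<mu> A\<^sup>-\<^sup>1 \<le> c (1 - \<delta>) A\<^sup>-\<^sup>1 \<le> c T \<le> B \<le> T \<le> A\<^sup>-\<^sup>1\<close>.\<close>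
    have "loewner_le (n l) (\<mu> \<cdot>\<^sub>m mat_inv (A l)) ((c * (1 - \<delta>)) \<cdot>\<^sub>m mat_inv (A l))"
      by (rule smult_mat_inv_mono[OF Al \<mu>])
    moreover have "loewner_le (n l) ((c * (1 - \<delta>)) \<cdot>\<^sub>m mat_inv (A l)) (c \<cdot>\<^sub>m T)"
    proof -
      have "c \<cdot>\<^sub>m ((1 - \<delta>) \<cdot>\<^sub>m mat_inv (A l)) = (c * (1 - \<delta>)) \<cdot>\<^sub>m mat_inv (A l)"
        by (rule eq_matI) auto
      then show ?thesis
        using loewner_le_smult[OF _ T(1) c(1) T_bounds(1)] mat_inv_spd(1)[OF Al(1,2,1)] by simp
    qed
    moreover have "loewner_le (n l) (c \<cdot>\<^sub>m T) (B l)"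
      unfolding T_def Bl by (rule cycle_step_smult_le[OF hyps C(1,2) D c C(3)])
    moreover have "loewner_le (n l) (B l) T"
      unfolding T_def Bl by (rule cycle_step_mono[OF hyps C(1,2) D C(4)])
    ultimately show ?case
      using T_bounds(2) cycle_step_properties(1,2)[OF hyps C(1,2)] unfolding Bl
      by (meson loewner_le_trans)
  qed
qed

theorem theorem3:
  fixes J k :: nat
    and n :: "nat \<Rightarrow> nat"
    and A P M :: "nat \<Rightarrow> real mat"
    and \<delta> :: real
  assumes "J \<ge> 2"
    and "\<And>l. l \<in> {1..J} \<Longrightarrow> n l \<ge> 1"
    and "\<And>l. l \<in> {1..J} \<Longrightarrow> A l \<in> carrier_mat (n l) (n l)"
    and "\<And>l. l \<in> {1..J} \<Longrightarrow> spd_mat (A l)"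
    and "\<And>l. l \<in> {1..<J} \<Longrightarrow> P l \<in> carrier_mat (n l) (n (Suc l))"
    and "\<And>l. l \<in> {1..<J} \<Longrightarrow> A (Suc l) = (P l)\<^sup>T * A l * P l"
    and "\<And>l. l \<in> {1..<J} \<Longrightarrow> M l \<in> carrier_mat (n l) (n l)"
    and "\<And>l. l \<in> {1..<J} \<Longrightarrow> invertible_mat (M l)"
    and "\<And>l. l \<in> {1..<J} \<Longrightarrow> energy_opnorm (A l) (1\<^sub>m (n l) - M l * A l) \<le> 1"
    and "two_grid_converges_uniformly J A P M \<delta>"
    and "k \<ge> 2"
  shows "(\<forall>\<mu>. 0 < \<mu> \<and> \<mu> < 1 \<and> \<mu> \<le> (1 - poly (amli_poly k \<mu>) \<mu>) * (1 - \<delta>) \<longrightarrow>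
            (\<forall>l \<in> {1..J}. cond_number_le (amli_B (amli_poly k \<mu>) J A P M l * A l) (1 / \<mu>)))
       \<and> (\<delta> < 1 - 1 / (real k)\<^sup>2 \<longrightarrow>
            (\<exists>\<mu>. 0 < \<mu> \<and> \<mu> < 1 \<and> \<mu> \<le> (1 - poly (amli_poly k \<mu>) \<mu>) * (1 - \<delta>)))"
proof (intro conjI allI impI ballI)
  fix \<mu> :: real and l
  assume \<mu>: "0 < \<mu> \<and> \<mu> < 1 \<and> \<mu> \<le> (1 - poly (amli_poly k \<mu>) \<mu>) * (1 - \<delta>)"
    and l: "l \<in> {1..J}"
  let ?p = "amli_poly k \<mu>"
  note p = amli_poly_bounds[of k \<mu>]
  have "0 \<le> poly ?p x \<and> poly ?p x \<le> 1 - (1 - poly ?p \<mu>)" if "\<mu> \<le> x" "x \<le> 1" for x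
    using p(3,4)[of x] \<mu> assms(11) that by simp
  then have "amli_B ?p J A P M l \<in> carrier_mat (n l) (n l)
    \<and> (amli_B ?p J A P M l)\<^sup>T = amli_B ?p J A P M l
    \<and> loewner_le (n l) (\<mu> \<cdot>\<^sub>m mat_inv (A l)) (amli_B ?p J A P M l)
    \<and> loewner_le (n l) (amli_B ?p J A P M l) (1 \<cdot>\<^sub>m mat_inv (A l))"
    using p(1,2) \<mu> assms(11)
    by (intro amli_spectral_bounds[OF assms(3,4,5,7,8,9,10) _ _ _ _ l, where c = "1 - poly ?p \<mu>"]) auto
  then show "cond_number_le (amli_B ?p J A P M l * A l) (1 / \<mu>)"
    using cond_number_le_of_loewner_bounds[OF assms(3)[OF l] assms(4)[OF l]] assms(2)[OF l] \<mu> by simp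
next
  assume "\<delta> < 1 - 1 / (real k)\<^sup>2"
  then show "\<exists>\<mu>. 0 < \<mu> \<and> \<mu> < 1 \<and> \<mu> \<le> (1 - poly (amli_poly k \<mu>) \<mu>) * (1 - \<delta>)"
    using exists_amli_parameter[of k "1 - \<delta>"] assms(11) by simp
qed

end
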